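(* Let $c_0<1$ be real, $c=\{s\in\mathbb{C}:\operatorname{Re}s=c_0\}$, and let $f\in\mathcal{M}^{-1}(L_c)$ with associated function $f^*\in L_1(c)$. Let $r(t)=\sum_{k=0}^\infty a_kt^k$ be a power series with infinite radius of convergence such that $r(t)\neq0$ for $t>0$. Let $\gamma\in\mathbb{R}$, suppose $1/r\in L_1(\mathbb{R}_+;t^{\gamma-c_0}dt)$, let $$\rho(s)=\int_0^\infty\frac{t^{s-1}}{r(t)}\,dt$$ be the Mellin transform of $1/r$, and suppose $\rho\in L_1(1+\gamma-c_0-i\infty,\,1+\gamma-c_0+i\infty)$. Consider $$(Ff)(z)=\int_0^\infty k_z^-(x)f(x)\,dx,\qquad k_z^-(x)=\int_0^\infty\frac{e^{-x/t}}{r(t)}t^{z-1}\,dt,\quad x>0.$$ Then the transformation $F$ is well-defined, and for $\operatorname{Re}z=\gamma$ $$(Ff)(z)=\frac{1}{2\pi i}\int_{c_0-i\infty}^{c_0+i\infty}\Gamma(1-s)\rho(1+z-s)f^*(s)\,ds .$$ The operator $F$ is bounded from $\mathcal{M}^{-1}(L_c)$ into $L_1(\gamma-i\infty,\gamma+i\infty)$ and $$\|F\|\le\Gamma(1-c_0)\int_{-\infty}^{\infty}|\rho(1-c_0+\gamma-i\tau)|\,d\tau .$$ Moreover, when $\gamma<0$ and $(Ff)(z)/\Gamma(-z)\in L_1(\gamma-i\infty,\gamma+i\infty)$, then for all $x>0$ the inversion formula $$f(x)=\frac{1}{2\pi i}\int_{\gamma-i\infty}^{\gamma+i\infty}\hat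 k_z^-(x)(Ff)(z)\,dz,\qquad \hat k_z^-(x)=\sum_{k=0}^\infty\frac{a_kx^{k-z-1}}{\Gamma(k-z)},$$ holds, and the integral in it converges absolutely.
   Context: For real $c_0$ let $c=\{s\in\mathbb{C}:\operatorname{Re}s=c_0\}$. $\mathcal{M}^{-1}(L_c)$ denotes the space of functions $f(x)$, $x>0$, representable as $$f(x)=\frac{1}{2\pi i}\int_c f^*(s)x^{-s}\,ds$$ with $f^*\in L_1(c)$ (integrable on the vertical line $c$). It is a Banach space with the norm $\|f\|_{\mathcal{M}^{-1}(L_c)}=\frac{1}{2\pi}\int_{-\infty}^{\infty}|f^*(c_0+it)|\,dt$. The function $f^*$ always denotes the one in this representation of $f$. For real $\gamma$, $L_1(\gamma-i\infty,\gamma+i\infty)$ is the space of functions $g$ on the vertical line $\operatorname{Re}z=\gamma$ with norm $\|g\|_1=\int_{-\infty}^{\infty}|g(\gamma+i\tau)|\,d\tau<\infty$. $\mathbb{R}_+=(0,\infty)$, and $L_1(\mathbb{R}_+;t^{\gamma-c_0}dt)$ is the space of functions on $\mathbb{R}_+$ integrable with respect to $t^{\gamma-c_0}dt$. $\Gamma$ is Euler's gamma-function. *)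

theory Defs
  imports "HOL-Analysis.Analysis"
begin

text \<open>
  Integration along the vertical line \<open>Re s = c\<close>, oriented upwards; the factor \<open>\<i>\<close> is the
  Jacobian \<open>ds = \<i> dt\<close> of \<open>s = c + \<i>t\<close>. All integrals are Lebesgue integrals.
\<close>

definition vline_integrable :: "real \<Rightarrow> (complex \<Rightarrow> complex) \<Rightarrow> bool" where
  "vline_integrable c g \<longleftrightarrow> integrable lborel (\<lambda>t::real. g (Complex c t))"

definition vline_integral :: "real \<Rightarrow> (complex \<Rightarrow> complex) \<Rightarrow> complex" where
  "vline_integral c g = \<i> * (LINT t|lborel. g (Complex c t))"

definition vline_norm :: "real \<Rightarrow> (complex \<Rightarrow> complex) \<Rightarrow> real" where
  "vline_norm c g = (LINT t|lborel. cmod (g (Complex c t)))"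

text \<open>
  A function on \<open>(0,\<infinity>)\<close> is represented by a function on \<open>real\<close> whose values at \<open>x \<le> 0\<close>
  are irrelevant; likewise only the values on the respective line matter for functions on a line.
\<close>

definition mellin_rep :: "real \<Rightarrow> (real \<Rightarrow> complex) \<Rightarrow> (complex \<Rightarrow> complex) \<Rightarrow> bool" where
  "mellin_rep c f fs \<longleftrightarrow> vline_integrable c fs \<and>
     (\<forall>x>0. f x = 1 / (2 * of_real pi * \<i>) *
              vline_integral c (\<lambda>s. fs s * of_real x powr (- s)))"

definition mellin_inv_space :: "real \<Rightarrow> (real \<Rightarrow> complex) set" where
  "mellin_inv_space c = {f. \<exists>fs. mellin_rep c f fs}"

text \<open>
  The representing function is determined by \<open>f\<close> almost everywhere on the line, so the norm
  below does not depend on the choice.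
\<close>

definition mellin_star :: "real \<Rightarrow> (real \<Rightarrow> complex) \<Rightarrow> complex \<Rightarrow> complex" where
  "mellin_star c f = (SOME fs. mellin_rep c f fs)"

definition mellin_inv_norm :: "real \<Rightarrow> (real \<Rightarrow> complex) \<Rightarrow> real" where
  "mellin_inv_norm c f = 1 / (2 * pi) * vline_norm c (mellin_star c f)"

text \<open>
  Bounded linear operators from \<open>mellin_inv_space c\<close> into the space of integrable functions on
  the line \<open>Re z = \<gamma>\<close>, and their operator norm.
\<close>

definition bounded_op ::
  "real \<Rightarrow> real \<Rightarrow> ((real \<Rightarrow> complex) \<Rightarrow> complex \<Rightarrow> complex) \<Rightarrow> bool" where
  "bounded_op c \<gamma> T \<longleftrightarrow>
     (\<forall>f\<in>mellin_inv_space c. vline_integrable \<gamma> (T f)) \<and>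
     (\<forall>f\<in>mellin_inv_space c. \<forall>g\<in>mellin_inv_space c. \<forall>\<alpha> \<beta>. \<forall>z. Re z = \<gamma> \<longrightarrow>
        T (\<lambda>x. \<alpha> * f x + \<beta> * g x) z = \<alpha> * T f z + \<beta> * T g z) \<and>
     (\<exists>K. \<forall>f\<in>mellin_inv_space c. vline_norm \<gamma> (T f) \<le> K * mellin_inv_norm c f)"

definition op_norm ::
  "real \<Rightarrow> real \<Rightarrow> ((real \<Rightarrow> complex) \<Rightarrow> complex \<Rightarrow> complex) \<Rightarrow> real" where
  "op_norm c \<gamma> T =
     Inf {K. 0 \<le> K \<and> (\<forall>f\<in>mellin_inv_space c. vline_norm \<gamma> (T f) \<le> K * mellin_inv_norm c f)}"

definition mellin :: "(real \<Rightarrow> complex) \<Rightarrow> complex \<Rightarrow> complex" where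
  "mellin g s = (LBINT t:{0<..}. of_real t powr (s - 1) * g t)"

definition kminus_integrand :: "(real \<Rightarrow> complex) \<Rightarrow> complex \<Rightarrow> real \<Rightarrow> real \<Rightarrow> complex" where
  "kminus_integrand r z x t = of_real (exp (- x / t)) / r t * of_real t powr (z - 1)"

definition kminus :: "(real \<Rightarrow> complex) \<Rightarrow> complex \<Rightarrow> real \<Rightarrow> complex" where
  "kminus r z x = (LBINT t:{0<..}. kminus_integrand r z x t)"

definition Ftrans :: "(real \<Rightarrow> complex) \<Rightarrow> (real \<Rightarrow> complex) \<Rightarrow> complex \<Rightarrow> complex" where
  "Ftrans r f z = (LBINT x:{0<..}. kminus r z x * f x)"

definition khat_term :: "(nat \<Rightarrow> complex) \<Rightarrow> complex \<Rightarrow> real \<Rightarrow> nat \<Rightarrow> complex" where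
  "khat_term a z x k = a k * of_real x powr (of_nat k - z - 1) / Gamma (of_nat k - z)"

definition khat :: "(nat \<Rightarrow> complex) \<Rightarrow> complex \<Rightarrow> real \<Rightarrow> complex" where
  "khat a z x = (\<Sum>k. khat_term a z x k)"

end

theory Submission
  imports Defs "HOL-Probability.Characteristic_Functions"
begin

text \<open>
  Write \<open>L f (p) = \<integral>\<^sub>0\<^sup>\<infinity> e\<^sup>-\<^sup>p\<^sup>x f(x) dx\<close> for the Laplace transform. The kernel of \<open>F\<close> is itself a Mellin
  integral, of \<open>e\<^sup>-\<^sup>x\<^sup>/\<^sup>t / r(t)\<close>, so exchanging two integrals turns \<open>F f\<close> into the Mellin transform of
  the function \<open>L f (1/t) / r(t)\<close> (lemma \<open>Ftrans_eq_mellin\<close>). The exchange is dominated, since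
  \<open>|f(x)|\<close> is at most a constant times \<open>x powr (- c0)\<close>, and the Laplace transform of that power is
  \<open>\<Gamma>(1 - c0) p powr (c0 - 1)\<close>, finite because \<open>c0 < 1\<close>; what remains is exactly the weight
  \<open>t powr (\<gamma> - c0) / |r(t)|\<close>.

  Taking the Laplace transform under the integral that represents \<open>f\<close> gives \<open>L f (p)\<close> as the
  integral of \<open>f\<^sup>*(s) \<Gamma>(1 - s) p powr (s - 1) / (2 \<pi> i)\<close> over the line \<open>c\<close>. Inserted in the previous
  formula, this yields the formula for \<open>F f\<close> in terms of \<open>\<rho>\<close> and \<open>f\<^sup>*\<close> (\<open>Ftrans_line_formula\<close>).
  Along the line \<open>Re z = \<gamma>\<close> it is a convolution of the integrable functions \<open>\<Gamma>(1 - s) f\<^sup>*(s)\<close>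
  and \<open>\<rho>\<close>; together with \<open>|\<Gamma>(1 - s)| \<le> \<Gamma>(1 - c0)\<close>, the usual estimate of the
  \<open>L\<^sub>1\<close> norm of a convolution is the bound on the operator norm (\<open>Ftrans_bounded\<close>).

  For the inversion formula, \<open>L f (1/t) / r(t)\<close> is continuous and has the integrable Mellin
  transform \<open>F f\<close>, so Mellin inversion with \<open>t = 1/p\<close> expresses \<open>2 \<pi> i L f (p)\<close> as the integral
  of \<open>(F f)(z) p\<^sup>z r(1/p)\<close> over the line \<open>Re z = \<gamma>\<close> (\<open>laplace_eq_Ftrans\<close>). Expanding \<open>r(1/p)\<close>
  produces the powers \<open>p powr (z - k)\<close>, and for \<open>\<gamma> < 0\<close> each of them is the Laplace transform of
  \<open>x powr (k - z - 1) / \<Gamma>(k - z)\<close>. Thus \<open>p\<^sup>z r(1/p)\<close> is the Laplace transform of the inverse kernel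
  (\<open>laplace_khat\<close>), and the two sides of the inversion formula have the same Laplace transform.
  Both are continuous, hence equal (\<open>laplace_transform_injective\<close>). All exchanges of integrals and
  sums here rest on one estimate, \<open>|khat a z x| \<le> khat_majorant x / |\<Gamma>(-z)|\<close>, which separates
  \<open>x\<close> from \<open>z\<close>; this is where the integrability of \<open>(F f)(z) / \<Gamma>(-z)\<close> enters.

  Two classical theorems are proved on the way. Fourier inversion, for an integrable function with
  integrable transform at a point of continuity, comes from regularising with a Gaussian;
  the substitution \<open>t = e\<^sup>u\<close> turns it into Mellin inversion. Injectivity of the Laplace transform
  comes from approximating a continuous function of \<open>e\<^sup>-\<^sup>x\<close> uniformly by polynomials.
\<close>

section \<open>Measurability of complex powers and of the Gamma function\<close>

lemma of_real_powr_exp: "x > 0 \<Longrightarrow> complex_of_real x powr w = exp (w * of_real (ln x))"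
  by (simp add: powr_def Ln_of_real)

text \<open>
  \<open>Ln\<close> is discontinuous on the negative real axis, so continuity does not help; but on
  each of the two half lines the power of a real base is an explicit exponential.
\<close>

lemma borel_measurable_of_real_powr [measurable (raw)]:
  assumes [measurable]: "f \<in> borel_measurable M" "g \<in> borel_measurable M"
  shows "(\<lambda>x. complex_of_real (f x) powr g x) \<in> borel_measurable M"
proof -
  have "(\<lambda>x. complex_of_real (f x) powr g x) =
        (\<lambda>x. if f x = 0 then 0 else if f x > 0 then exp (g x * of_real (ln (f x)))
             else exp (g x * (of_real (ln (- f x)) + \<i> * of_real pi)))"
    (is "_ = ?h")
  proof
    fix x
    have "Ln (complex_of_real (f x)) = of_real (ln (- f x)) + \<i> * of_real pi" if "f x < 0"
    proof -
      have "Ln (- complex_of_real (- f x)) = of_real (ln (- f x)) + \<i> * of_real pi"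
        using that by (subst Ln_minus) (auto simp: Ln_of_real simp del: of_real_minus)
      then show ?thesis by simp
    qed
    then show "complex_of_real (f x) powr g x = ?h x"
      by (auto simp: powr_def Ln_of_real)
  qed
  also have "?h \<in> borel_measurable M"
    by measurable
  finally show ?thesis .
qed

lemma borel_measurable_Complex [measurable (raw)]:
  assumes [measurable]: "f \<in> borel_measurable M" "g \<in> borel_measurable M"
  shows "(\<lambda>x. Complex (f x) (g x)) \<in> borel_measurable M"
  by (subst borel_measurable_complex_iff) simp

lemma borel_measurable_Gamma_complex [measurable]:
  "(Gamma :: complex \<Rightarrow> complex) \<in> borel_measurable borel"
proof -
  have [measurable]: "(rGamma :: complex \<Rightarrow> complex) \<in> borel_measurable borel"
    by (intro borel_measurable_continuous_onI continuous_intros)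
  have "Gamma = (\<lambda>z :: complex. inverse (rGamma z))"
    by (simp add: fun_eq_iff rGamma_inverse_Gamma)
  also have "\<dots> \<in> borel_measurable borel" by measurable
  finally show ?thesis .
qed

section \<open>Integrals with a parameter\<close>

text \<open>
  A combined form of the theorems of Tonelli and Fubini: every exchange of integrals below is
  justified by a bound on the \<open>L\<^sub>1\<close> norms of the sections. The second part is the triangle
  inequality for integrals followed by an exchange.
\<close>

lemma integrable_pair_bounded_sections:
  fixes K :: "real \<Rightarrow> real \<Rightarrow> complex"
  assumes meas [measurable]: "case_prod K \<in> borel_measurable (lborel \<Otimes>\<^sub>M lborel)"
    and sect: "\<And>x. integrable lborel (K x)"
    and le: "\<And>x. (LINT y|lborel. norm (K x y)) \<le> B x"
    and B: "integrable lborel B"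
  shows "integrable (lborel \<Otimes>\<^sub>M lborel) (case_prod K)"
    and "(LINT y|lborel. norm (LINT x|lborel. K x y)) \<le> (LINT x|lborel. B x)"
proof -
  have int1: "integrable lborel (\<lambda>x. LINT y|lborel. norm (case_prod K (x, y)))"
  proof (rule Bochner_Integration.integrable_bound[OF B])
    show "AE x in lborel. norm (LINT y|lborel. norm (case_prod K (x, y))) \<le> norm (B x)"
    proof (rule AE_I2)
      fix x
      have "0 \<le> (LINT y|lborel. norm (K x y))" by simp
      with le[of x] show "norm (LINT y|lborel. norm (case_prod K (x, y))) \<le> norm (B x)"
        by simp
    qed
  qed measurable
  show int: "integrable (lborel \<Otimes>\<^sub>M lborel) (case_prod K)"
    by (rule lborel_pair.Fubini_integrable[OF meas int1]) (simp add: sect)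
  have intn: "integrable (lborel \<Otimes>\<^sub>M lborel) (\<lambda>(x, y). norm (K x y))"
    using integrable_norm[OF int] by (simp add: case_prod_unfold)
  have "(LINT y|lborel. norm (LINT x|lborel. K x y)) \<le> (LINT y|lborel. LINT x|lborel. norm (K x y))"
    by (intro integral_mono integrable_norm lborel_pair.integrable_snd[OF int]
        lborel_pair.integrable_snd[OF intn] integral_norm_bound)
  also have "\<dots> = (LINT x|lborel. LINT y|lborel. norm (K x y))"
    by (rule lborel_pair.Fubini_integral[OF intn])
  also have "\<dots> \<le> (LINT x|lborel. B x)"
    using int1 by (intro integral_mono B le) simp
  finally show "(LINT y|lborel. norm (LINT x|lborel. K x y)) \<le> (LINT x|lborel. B x)" .
qed

text \<open>
  Dominated convergence along sequences. The dominating function is split as \<open>B x * w y\<close>, so that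
  near a point \<open>x0\<close> the factor \<open>B x\<close> may be replaced by the constant \<open>B x0 + 1\<close>.
\<close>

lemma continuous_on_integral_dominated:
  fixes K :: "real \<Rightarrow> real \<Rightarrow> complex"
  assumes meas: "\<And>x. x \<in> S \<Longrightarrow> K x \<in> borel_measurable lborel"
    and cont: "\<And>y. continuous_on S (\<lambda>x. K x y)"
    and w: "integrable lborel w" and B: "continuous_on S B"
    and dom: "\<And>x y. x \<in> S \<Longrightarrow> norm (K x y) \<le> B x * w y"
    and w0: "\<And>y. w y \<ge> 0"
  shows "continuous_on S (\<lambda>x. LINT y|lborel. K x y)"
  unfolding continuous_on_sequentially o_def
proof (intro allI ballI impI)
  fix X x0 assume x0: "x0 \<in> S" and "(\<forall>n. X n \<in> S) \<and> X \<longlonglongrightarrow> x0"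
  then have X: "\<And>n. X n \<in> S" and lim: "X \<longlonglongrightarrow> x0" by auto
  have "(\<lambda>n. B (X n)) \<longlonglongrightarrow> B x0"
    using B x0 X lim unfolding continuous_on_sequentially o_def by blast
  then have "\<forall>\<^sub>F n in sequentially. B (X n) < B x0 + 1"
    by (rule order_tendstoD) simp
  then obtain N where N: "\<And>n. n \<ge> N \<Longrightarrow> B (X n) \<le> B x0 + 1"
    unfolding eventually_sequentially by (auto intro: less_imp_le)
  show "(\<lambda>n. LINT y|lborel. K (X n) y) \<longlonglongrightarrow> (LINT y|lborel. K x0 y)"
  proof (rule LIMSEQ_offset, rule integral_dominated_convergence[where w = "\<lambda>y. (B x0 + 1) * w y"])
    show "AE y in lborel. (\<lambda>n. K (X (n + N)) y) \<longlonglongrightarrow> K x0 y"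
    proof (rule AE_I2)
      fix y
      have "(\<lambda>n. K (X n) y) \<longlonglongrightarrow> K x0 y"
        using cont[of y] x0 X lim unfolding continuous_on_sequentially o_def by blast
      then show "(\<lambda>n. K (X (n + N)) y) \<longlonglongrightarrow> K x0 y" by (rule LIMSEQ_ignore_initial_segment)
    qed
    show "AE y in lborel. norm (K (X (n + N)) y) \<le> (B x0 + 1) * w y" for n
      using order_trans[OF dom[OF X] mult_right_mono[OF N w0]] by simp
  qed (use meas x0 X w in auto)
qed

lemma continuous_on_entire_power_series:
  fixes b :: "nat \<Rightarrow> 'a :: {real_normed_field, banach}"
  assumes "\<And>x. x \<ge> 0 \<Longrightarrow> summable (\<lambda>k. norm (b k) * x ^ k)"
  shows "continuous_on UNIV (\<lambda>t. \<Sum>k. b k * of_real t ^ k)"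
proof -
  have "summable (\<lambda>k. b k * z ^ k)" for z
    by (rule summable_norm_cancel) (use assms[of "norm z"] in \<open>simp add: norm_mult norm_power\<close>)
  then have "isCont (\<lambda>z. \<Sum>k. b k * z ^ k) z" for z
    by (rule isCont_powser_converges_everywhere)
  then have "continuous_on UNIV (\<lambda>z. \<Sum>k. b k * z ^ k)"
    by (simp add: continuous_on_eq_continuous_at)
  from continuous_on_compose2[OF this, of UNIV of_real] show ?thesis
    by (auto intro: continuous_intros)
qed

section \<open>Laplace transforms of powers\<close>

text \<open>
  Euler's integral after the substitution \<open>x \<mapsto> p x\<close>. It is the Laplace transform of
  \<open>x powr (w - 1)\<close>, and this is its main use below.
\<close>

lemma Gamma_integral_scaled:
  fixes w :: complex and p :: real
  assumes w: "Re w > 0" and p: "p > 0"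
  shows "set_integrable lborel {0<..} (\<lambda>x. of_real (exp (- (p * x))) * of_real x powr (w - 1))"
    and "(LBINT x:{0<..}. of_real (exp (- (p * x))) * of_real x powr (w - 1))
           = Gamma w * of_real p powr (- w)"
proof -
  define h where "h = (\<lambda>x. indicator {0<..} x *\<^sub>R (of_real (exp (- x)) * complex_of_real x powr (w - 1)))"
  define hp where "hp = (\<lambda>x. indicator {0<..} x *\<^sub>R (of_real (exp (- (p * x))) * complex_of_real x powr (w - 1)))"
  have hm [measurable]: "h \<in> borel_measurable lborel" unfolding h_def by measurable
  have heq: "h = (\<lambda>x. indicator {0<..} x *\<^sub>R (of_real x powr (w - 1) / of_real (exp x)))"
    by (simp add: h_def exp_minus field_simps fun_eq_iff)
  have inth: "integrable lborel h"
    using absolutely_integrable_Gamma_integral'[OF w] hm unfolding set_integrable_def heq[symmetric]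
    by (simp add: integrable_completion)
  have "(LBINT x:{0<..}. of_real x powr (w - 1) / of_real (exp x)) = Gamma w"
  proof -
    have "set_integrable lborel {0<..} (\<lambda>x. of_real x powr (w - 1) / of_real (exp x))"
      using inth by (simp add: set_integrable_def heq)
    from set_borel_integral_eq_integral(2)[OF this] show ?thesis
      using Gamma_integral_complex'[OF w] by (simp add: integral_unique)
  qed
  then have Ih: "integral\<^sup>L lborel h = Gamma w" by (simp add: heq set_lebesgue_integral_def)
  have sc: "h (0 + p * x) = of_real p powr (w - 1) * hp x" for x
  proof (cases "x > 0")
    case True
    then show ?thesis using p
      by (simp add: h_def hp_def of_real_powr_exp ln_mult algebra_simps exp_add exp_diff del: of_real_mult)
  next
    case False
    then show ?thesis using p by (auto simp: h_def hp_def zero_less_mult_iff)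
  qed
  have nz: "of_real p powr (w - 1) \<noteq> 0" using p by simp
  from lborel_integrable_real_affine[OF inth, of p 0] p
  have "integrable lborel (\<lambda>x. of_real p powr (w - 1) * hp x)" by (simp only: sc)
  then have "integrable lborel (\<lambda>x. inverse (of_real p powr (w - 1)) * (of_real p powr (w - 1) * hp x))"
    by (rule integrable_mult_right)
  then have "integrable lborel hp" using nz by (simp flip: mult.assoc)
  then show "set_integrable lborel {0<..} (\<lambda>x. of_real (exp (- (p * x))) * of_real x powr (w - 1))"
    unfolding set_integrable_def hp_def .
  have "Gamma w = p *\<^sub>R (LINT x|lborel. of_real p powr (w - 1) * hp x)"
    using lborel_integral_real_affine[of p h 0] p by (simp only: sc Ih) simp
  also have "\<dots> = of_real p * of_real p powr (w - 1) * integral\<^sup>L lborel hp"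
    by (simp add: scaleR_conv_of_real)
  also have "of_real p * of_real p powr (w - 1) = of_real p powr w"
    using p by (simp add: powr_diff)
  finally show "(LBINT x:{0<..}. of_real (exp (- (p * x))) * of_real x powr (w - 1))
           = Gamma w * of_real p powr (- w)"
    using p by (simp add: set_lebesgue_integral_def hp_def powr_minus field_simps)
qed

lemma Gamma_integral_scaled_real:
  fixes b p :: real
  assumes b: "b > 0" and p: "p > 0"
  shows "set_integrable lborel {0<..} (\<lambda>x. exp (- (p * x)) * x powr (b - 1))"
    and "(LBINT x:{0<..}. exp (- (p * x)) * x powr (b - 1)) = Gamma b * p powr (- b)"
proof -
  let ?g = "\<lambda>x. indicator {0<..} x *\<^sub>R (exp (- (p * x)) * x powr (b - 1))"
  have eq: "indicator {0<..} x *\<^sub>R (of_real (exp (- (p * x))) * of_real x powr (of_real b - 1))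
      = complex_of_real (?g x)" for x
  proof -
    have "complex_of_real b - 1 = of_real (b - 1)" by simp
    then show ?thesis by (cases "x > 0") (simp_all add: powr_of_real del: of_real_diff)
  qed
  have "integrable lborel (\<lambda>x. complex_of_real (?g x))"
    using Gamma_integral_scaled(1)[of "of_real b" p] assms by (simp only: set_integrable_def eq) simp
  then show "set_integrable lborel {0<..} (\<lambda>x. exp (- (p * x)) * x powr (b - 1))"
    unfolding set_integrable_def complex_of_real_integrable_eq .
  have "complex_of_real (integral\<^sup>L lborel ?g) = of_real (Gamma b * p powr (- b))"
    using Gamma_integral_scaled(2)[of "of_real b" p] assms
    by (simp only: set_lebesgue_integral_def eq integral_complex_of_real)
      (simp add: Gamma_complex_of_real powr_of_real del: of_real_minus add: of_real_minus[symmetric])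
  then show "(LBINT x:{0<..}. exp (- (p * x)) * x powr (b - 1)) = Gamma b * p powr (- b)"
    unfolding set_lebesgue_integral_def of_real_eq_iff .
qed

lemma norm_Gamma_le:
  assumes w: "Re w > 0" shows "cmod (Gamma w) \<le> Gamma (Re w)"
proof -
  have "Gamma w = (LINT x|lborel. indicator {0<..} x *\<^sub>R (of_real (exp (- x)) * of_real x powr (w - 1)))"
    using Gamma_integral_scaled(2)[OF w zero_less_one] by (simp add: set_lebesgue_integral_def)
  also have "cmod \<dots> \<le> (LINT x|lborel. norm (indicator {0<..} x *\<^sub>R (of_real (exp (- x)) * complex_of_real x powr (w - 1))))"
    by (rule integral_norm_bound)
  also have "\<dots> = (LINT x|lborel. indicator {0<..} x *\<^sub>R (exp (- x) * x powr (Re w - 1)))"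
    by (rule Bochner_Integration.integral_cong) (auto simp: norm_mult norm_powr_real_powr indicator_def)
  also have "\<dots> = Gamma (Re w)"
    using Gamma_integral_scaled_real(2)[OF w zero_less_one] by (simp add: set_lebesgue_integral_def)
  finally show ?thesis .
qed

section \<open>Fourier inversion\<close>

text \<open>
  The Gaussian of width \<open>m\<close> is regularising and has an explicit transform, known here as the
  characteristic function of the standard normal distribution.
\<close>

lemma gaussian_fourier_transform:
  fixes m w :: real
  assumes m: "m > 0"
  shows "integrable lborel (\<lambda>y. exp (- (y / m)\<^sup>2 / 2))"
    and "(LINT y|lborel. iexp (w * y) * of_real (exp (- (y / m)\<^sup>2 / 2)))
           = of_real (m * sqrt (2 * pi) * exp (- (m * w)\<^sup>2 / 2))"
proof -
  have gauss: "exp (- x\<^sup>2 / 2) = sqrt (2 * pi) * std_normal_density x" for x :: real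
    by (simp add: std_normal_density_def)
  have "integrable lborel (\<lambda>x. sqrt (2 * pi) * std_normal_density x)"
    by simp
  then have "integrable lborel (\<lambda>x :: real. exp (- x\<^sup>2 / 2))"
    by (simp only: gauss)
  from lborel_integrable_real_affine[OF this, of "1 / m" 0] m
  show "integrable lborel (\<lambda>y. exp (- (y / m)\<^sup>2 / 2))" by simp
  have "(LINT y|lborel. iexp (w * y) * of_real (exp (- (y / m)\<^sup>2 / 2)))
      = m *\<^sub>R (LINT x|lborel. iexp (w * (m * x)) * of_real (exp (- x\<^sup>2 / 2)))"
    using lborel_integral_real_affine[of m "\<lambda>y. iexp (w * y) * of_real (exp (- (y / m)\<^sup>2 / 2))" 0] m
    by simp
  also have "(LINT x|lborel. iexp (w * (m * x)) * of_real (exp (- x\<^sup>2 / 2)))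
      = (LINT x|lborel. of_real (sqrt (2 * pi)) * (std_normal_density x *\<^sub>R iexp ((m * w) * x)))"
    by (rule Bochner_Integration.integral_cong[OF refl], subst gauss) (simp add: scaleR_conv_of_real mult_ac)
  also have "\<dots> = of_real (sqrt (2 * pi)) * char std_normal_distribution (m * w)"
    unfolding char_def integral_mult_right_zero by (subst integral_density) simp_all
  also have "char std_normal_distribution (m * w) = of_real (exp (- (m * w)\<^sup>2 / 2))"
    by (simp add: char_std_normal_distribution)
  finally show "(LINT y|lborel. iexp (w * y) * of_real (exp (- (y / m)\<^sup>2 / 2)))
           = of_real (m * sqrt (2 * pi) * exp (- (m * w)\<^sup>2 / 2))"
    by (simp add: scaleR_conv_of_real)
qed

text \<open>
  Split \<open>G\<close> at distance \<open>\<delta>\<close> from \<open>v\<close>, where \<open>G\<close> is bounded on the inner part by continuity.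
  There, rescaling the variable makes the Gaussian independent of \<open>n\<close> and dominated convergence
  applies. On the outer part the Gaussian is \<open>O(1/n)\<close> uniformly, so integrability
  of \<open>G\<close> is enough.
\<close>

lemma gaussian_approximate_identity:
  fixes G :: "real \<Rightarrow> complex"
  assumes G: "integrable lborel G" and cont: "isCont G v"
  shows "(\<lambda>n. LINT u|lborel. G u * of_real (real (Suc n) * sqrt (2 * pi) * exp (- (real (Suc n) * (u - v))\<^sup>2 / 2)))
           \<longlonglongrightarrow> 2 * of_real pi * G v"
proof -
  have Gm [measurable]: "G \<in> borel_measurable lborel" using G by simp
  define q :: "real \<Rightarrow> real" where "q x = sqrt (2 * pi) * exp (- x\<^sup>2 / 2)" for x
  \<comment> \<open>\<open>q\<close> has total mass \<open>2 \<pi>\<close>, which is the constant in the inversion formula.\<close>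
  have qeq: "q x = 2 * pi * std_normal_density x" for x
    using real_sqrt_mult_self[of "2 * pi"] by (simp add: q_def std_normal_density_def field_simps)
  have qint: "integrable lborel q" unfolding qeq by simp
  have qtot: "integral\<^sup>L lborel q = 2 * pi" unfolding qeq by simp
  have qm [measurable]: "q \<in> borel_measurable borel" unfolding q_def by measurable
  have q0: "q x \<ge> 0" for x by (simp add: q_def)
  have qdecay: "q x \<le> sqrt (2 * pi) * 2 / x\<^sup>2" if "x \<noteq> 0" for x
  proof -
    have "exp (x\<^sup>2 / 2) \<ge> x\<^sup>2 / 2"
      using exp_ge_add_one_self[of "x\<^sup>2 / 2"] by linarith
    then have "exp (- x\<^sup>2 / 2) \<le> 2 / x\<^sup>2"
      using that by (simp add: exp_minus field_simps)
    from mult_left_mono[OF this, of "sqrt (2 * pi)"] show ?thesis by (simp add: q_def)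
  qed
  obtain \<delta> where d: "\<delta> > 0" and near: "\<And>u. \<bar>u - v\<bar> < \<delta> \<Longrightarrow> norm (G u - G v) < 1"
    using cont[unfolded continuous_at_eps_delta, rule_format, of 1] by (auto simp: dist_norm)
  define G1 where "G1 = (\<lambda>u. indicator {u. \<bar>u - v\<bar> < \<delta>} u *\<^sub>R G u)"
  define G2 where "G2 = (\<lambda>u. indicator {u. \<not> \<bar>u - v\<bar> < \<delta>} u *\<^sub>R G u)"
  have [measurable]: "G1 \<in> borel_measurable lborel" "G2 \<in> borel_measurable lborel"
    unfolding G1_def G2_def by measurable
  have split: "G u = G1 u + G2 u" for u by (simp add: G1_def G2_def indicator_def)
  have G1b: "norm (G1 u) \<le> norm (G v) + 1" for u
  proof (cases "\<bar>u - v\<bar> < \<delta>")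
    case True
    then show ?thesis using near[of u] norm_triangle_ineq2[of "G u" "G v"] by (simp add: G1_def)
  qed (simp add: G1_def add_nonneg_nonneg)
  define k :: "nat \<Rightarrow> real \<Rightarrow> real" where "k n u = real (Suc n) * q (real (Suc n) * (u - v))" for n u
  have [measurable]: "k n \<in> borel_measurable borel" for n unfolding k_def by measurable
  have kint: "integrable lborel (k n)" for n
  proof -
    have "integrable lborel (\<lambda>u. q (- (real (Suc n) * v) + real (Suc n) * u))"
      by (rule lborel_integrable_real_affine[OF qint]) simp
    then have "integrable lborel (\<lambda>u. q (real (Suc n) * (u - v)))"
      by (simp add: algebra_simps)
    then show ?thesis unfolding k_def by simp
  qed
  have k0: "k n u \<ge> 0" for n u by (simp add: k_def q0)
  have I1: "integrable lborel (\<lambda>u. G1 u * of_real (k n u))" for n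
  proof (rule Bochner_Integration.integrable_bound[where f = "\<lambda>u. (norm (G v) + 1) * k n u"])
    show "AE u in lborel. norm (G1 u * complex_of_real (k n u)) \<le> norm ((norm (G v) + 1) * k n u)"
      using G1b k0 by (intro AE_I2) (simp add: norm_mult mult_right_mono)
  qed (use kint in auto)
  have far: "norm (G2 u * of_real (k n u)) \<le> inverse (real (Suc n)) * (sqrt (2 * pi) * 2 / \<delta>\<^sup>2 * norm (G u))" for n u
  proof (cases "\<bar>u - v\<bar> < \<delta>")
    case False
    then have uv: "u - v \<noteq> 0" "\<delta> \<le> \<bar>u - v\<bar>" using d by auto
    have "k n u \<le> real (Suc n) * (sqrt (2 * pi) * 2 / (real (Suc n) * (u - v))\<^sup>2)"
      unfolding k_def by (rule mult_left_mono[OF qdecay]) (use uv in auto)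
    also have "\<dots> = inverse (real (Suc n)) * (sqrt (2 * pi) * 2 / \<bar>u - v\<bar>\<^sup>2)"
    proof -
      have "N * (c / (N\<^sup>2 * D)) = inverse N * (c / D)" if "N \<noteq> 0" for N c D :: real
        using that by (simp add: power2_eq_square field_simps)
      from this[of "real (Suc n)"] show ?thesis by (simp add: power_mult_distrib del: of_nat_Suc)
    qed
    also have "\<dots> \<le> inverse (real (Suc n)) * (sqrt (2 * pi) * 2 / \<delta>\<^sup>2)"
      using uv d by (intro mult_left_mono divide_left_mono power_mono mult_pos_pos) auto
    finally have "k n u * norm (G u) \<le> inverse (real (Suc n)) * (sqrt (2 * pi) * 2 / \<delta>\<^sup>2) * norm (G u)"
      by (rule mult_right_mono) simp
    then show ?thesis
      using k0[of n u] False by (simp add: G2_def norm_mult mult_ac del: of_nat_Suc)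
  qed (use d in \<open>simp add: G2_def\<close>)
  have I2: "integrable lborel (\<lambda>u. G2 u * of_real (k n u))" for n
    by (rule Bochner_Integration.integrable_bound[where f = "\<lambda>u. inverse (real (Suc n)) * (sqrt (2 * pi) * 2 / \<delta>\<^sup>2 * norm (G u))"])
       (use far[of _ n] G d in \<open>auto simp del: of_nat_Suc intro!: AE_I2 intro: order_trans[OF _ abs_ge_self]\<close>)
  have lim2: "(\<lambda>n. LINT u|lborel. G2 u * of_real (k n u)) \<longlonglongrightarrow> 0"
  proof (rule Lim_null_comparison)
    show "\<forall>\<^sub>F n in sequentially. norm (LINT u|lborel. G2 u * of_real (k n u))
        \<le> inverse (real (Suc n)) * (LINT u|lborel. sqrt (2 * pi) * 2 / \<delta>\<^sup>2 * norm (G u))"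
    proof (intro always_eventually allI)
      fix n
      have "norm (LINT u|lborel. G2 u * of_real (k n u))
          \<le> (LINT u|lborel. inverse (real (Suc n)) * (sqrt (2 * pi) * 2 / \<delta>\<^sup>2 * norm (G u)))"
        by (rule Bochner_Integration.integral_norm_bound_integral[OF I2]) (use G far in \<open>auto simp del: of_nat_Suc\<close>)
      then show "norm (LINT u|lborel. G2 u * of_real (k n u))
        \<le> inverse (real (Suc n)) * (LINT u|lborel. sqrt (2 * pi) * 2 / \<delta>\<^sup>2 * norm (G u))"
        by (simp only: integral_mult_right_zero)
    qed
    show "(\<lambda>n. inverse (real (Suc n)) * (LINT u|lborel. sqrt (2 * pi) * 2 / \<delta>\<^sup>2 * norm (G u))) \<longlonglongrightarrow> 0"
      by (rule tendsto_mult_left_zero) (rule LIMSEQ_inverse_real_of_nat)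
  qed
  have sub: "(LINT u|lborel. G1 u * of_real (k n u))
      = (LINT x|lborel. G1 (v + inverse (real (Suc n)) * x) * of_real (q x))" for n
    by (subst lborel_integral_real_affine[of "inverse (real (Suc n))" _ v])
       (simp_all add: k_def scaleR_conv_of_real field_simps del: of_nat_Suc flip: integral_mult_right_zero)
  have "(\<lambda>n. LINT x|lborel. G1 (v + inverse (real (Suc n)) * x) * of_real (q x))
      \<longlonglongrightarrow> (LINT x|lborel. G v * of_real (q x))"
  proof (rule integral_dominated_convergence[where w = "\<lambda>x. (norm (G v) + 1) * q x"])
    show "AE x in lborel. (\<lambda>n. G1 (v + inverse (real (Suc n)) * x) * of_real (q x)) \<longlonglongrightarrow> G v * of_real (q x)"
    proof (rule AE_I2)
      fix x
      have "(\<lambda>n. v + inverse (real (Suc n)) * x) \<longlonglongrightarrow> v + 0 * x"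
        by (intro tendsto_intros LIMSEQ_inverse_real_of_nat)
      then have lv: "(\<lambda>n. v + inverse (real (Suc n)) * x) \<longlonglongrightarrow> v" by simp
      have "(\<lambda>n. G (v + inverse (real (Suc n)) * x)) \<longlonglongrightarrow> G v"
        by (rule isCont_tendsto_compose[OF cont lv])
      moreover have "\<forall>\<^sub>F n in sequentially. G1 (v + inverse (real (Suc n)) * x) = G (v + inverse (real (Suc n)) * x)"
        using tendstoD[OF lv d] by eventually_elim (simp add: G1_def dist_real_def)
      ultimately have "(\<lambda>n. G1 (v + inverse (real (Suc n)) * x)) \<longlonglongrightarrow> G v"
        by (simp add: tendsto_cong)
      then show "(\<lambda>n. G1 (v + inverse (real (Suc n)) * x) * of_real (q x)) \<longlonglongrightarrow> G v * of_real (q x)"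
        by (intro tendsto_intros)
    qed
    show "AE x in lborel. norm (G1 (v + inverse (real (Suc n)) * x) * complex_of_real (q x))
        \<le> (norm (G v) + 1) * q x" for n
      using G1b q0 by (intro AE_I2) (simp add: norm_mult mult_right_mono del: of_nat_Suc)
  qed (use qint in auto)
  also have "(LINT x|lborel. G v * of_real (q x)) = 2 * of_real pi * G v"
    by (simp add: qtot)
  finally have lim1: "(\<lambda>n. LINT u|lborel. G1 u * of_real (k n u)) \<longlonglongrightarrow> 2 * of_real pi * G v"
    by (simp only: sub)
  have "(LINT u|lborel. G u * of_real (k n u)) = (LINT u|lborel. G1 u * of_real (k n u)) + (LINT u|lborel. G2 u * of_real (k n u))" for n
    using I1[of n] I2[of n] by (simp add: split distrib_right del: of_real_mult)
  then have "(\<lambda>n. LINT u|lborel. G u * of_real (k n u)) \<longlonglongrightarrow> 2 * of_real pi * G v"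
    using tendsto_add[OF lim1 lim2] by simp
  then show ?thesis by (simp only: k_def q_def mult.assoc)
qed

text \<open>
  Multiply the transform by a Gaussian of width \<open>n\<close>. By dominated convergence the inverse integral
  converges to that of the transform itself; by Fubini it equals the integral of \<open>G\<close> against a narrow
  Gaussian around \<open>v\<close>, which converges to \<open>2 \<pi> G v\<close>.
\<close>

theorem fourier_inversion:
  fixes G :: "real \<Rightarrow> complex"
  assumes G: "integrable lborel G" and cont: "isCont G v"
    and Gh: "integrable lborel (\<lambda>y. LINT u|lborel. G u * iexp (y * u))"
  shows "G v = 1 / (2 * of_real pi) * (LINT y|lborel. (LINT u|lborel. G u * iexp (y * u)) * iexp (- (y * v)))"
proof -
  have Gm [measurable]: "G \<in> borel_measurable lborel" using G by simp
  define H where "H y = (LINT u|lborel. G u * iexp (y * u))" for y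
  have H: "integrable lborel H" using Gh by (simp add: H_def[abs_def])
  then have Hm [measurable]: "H \<in> borel_measurable lborel" by simp
  let ?e = "\<lambda>n y. exp (- (y / real (Suc n))\<^sup>2 / 2)"
  have e1: "?e n y \<le> 1" for n y by simp
  define A where "A n = (LINT y|lborel. H y * iexp (- (y * v)) * of_real (?e n y))" for n
  have lim1: "A \<longlonglongrightarrow> (LINT y|lborel. H y * iexp (- (y * v)))"
    unfolding A_def
  proof (rule integral_dominated_convergence[where w = "\<lambda>y. norm (H y)"])
    show "AE y in lborel. (\<lambda>n. H y * iexp (- (y * v)) * of_real (?e n y)) \<longlonglongrightarrow> H y * iexp (- (y * v))"
    proof (rule AE_I2)
      fix y
      have "(\<lambda>n. ?e n y) \<longlonglongrightarrow> exp (- (y * 0)\<^sup>2 / 2)"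
        unfolding divide_inverse[of y] by (intro tendsto_intros LIMSEQ_inverse_real_of_nat) simp
      then have "(\<lambda>n. ?e n y) \<longlonglongrightarrow> 1" by simp
      then have "(\<lambda>n. complex_of_real (?e n y)) \<longlonglongrightarrow> of_real 1" by (rule tendsto_of_real)
      from tendsto_mult[OF tendsto_const[of "H y * iexp (- (y * v))"] this]
      show "(\<lambda>n. H y * iexp (- (y * v)) * of_real (?e n y)) \<longlonglongrightarrow> H y * iexp (- (y * v))" by simp
    qed
    show "AE y in lborel. norm (H y * iexp (- (y * v)) * of_real (?e n y)) \<le> norm (H y)" for n
      using e1[of _ n] by (intro AE_I2) (auto simp: norm_mult norm_exp_eq_Re intro!: mult_right_le_one_le simp del: of_nat_Suc)
  qed (use H in auto)
  have Aeq: "A n = (LINT u|lborel. G u * of_real (real (Suc n) * sqrt (2 * pi) * exp (- (real (Suc n) * (u - v))\<^sup>2 / 2)))" for n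
  proof -
    define K where "K u y = G u * iexp ((u - v) * y) * of_real (?e n y)" for u y
    have eint: "integrable lborel (?e n)" using gaussian_fourier_transform(1)[of "real (Suc n)"] by simp
    have nK: "norm (K u y) = norm (G u) * ?e n y" for u y
      by (simp add: K_def norm_mult norm_exp_eq_Re del: of_nat_Suc)
    have int: "integrable (lborel \<Otimes>\<^sub>M lborel) (case_prod K)"
    proof (rule integrable_pair_bounded_sections(1))
      show "case_prod K \<in> borel_measurable (lborel \<Otimes>\<^sub>M lborel)"
        unfolding K_def case_prod_unfold by measurable
      show "integrable lborel (K u)" for u
      proof (rule Bochner_Integration.integrable_bound[where f = "\<lambda>y. norm (G u) * ?e n y"])
        show "integrable lborel (\<lambda>y. norm (G u) * ?e n y)" using eint by (rule integrable_mult_right)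
        show "K u \<in> borel_measurable lborel" unfolding K_def by measurable
      qed (simp add: nK del: of_nat_Suc)
      show "(LINT y|lborel. norm (K u y)) \<le> norm (G u) * (LINT y|lborel. ?e n y)" for u
        by (simp add: nK del: of_nat_Suc)
    qed (use G in simp)
    have "A n = (LINT y|lborel. LINT u|lborel. K u y)"
      unfolding A_def
    proof (rule Bochner_Integration.integral_cong[OF refl])
      fix y
      have "H y * iexp (- (y * v)) * of_real (?e n y)
          = (LINT u|lborel. G u * iexp (y * u) * (iexp (- (y * v)) * of_real (?e n y)))"
        unfolding integral_mult_left_zero H_def by (simp only: mult.assoc)
      also have "\<dots> = (LINT u|lborel. K u y)"
      proof (rule Bochner_Integration.integral_cong[OF refl])
        fix u
        have "iexp ((u - v) * y) = iexp (y * u) * iexp (- (y * v))"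
          by (simp add: exp_add[symmetric] algebra_simps)
        then show "G u * iexp (y * u) * (iexp (- (y * v)) * of_real (?e n y)) = K u y"
          by (simp only: K_def mult.assoc)
      qed
      finally show "H y * iexp (- (y * v)) * of_real (?e n y) = (LINT u|lborel. K u y)" .
    qed
    also have "\<dots> = (LINT u|lborel. LINT y|lborel. K u y)"
      by (rule lborel_pair.Fubini_integral[OF int])
    also have "\<dots> = (LINT u|lborel. G u * of_real (real (Suc n) * sqrt (2 * pi) * exp (- (real (Suc n) * (u - v))\<^sup>2 / 2)))"
    proof (rule Bochner_Integration.integral_cong[OF refl])
      fix u
      have "(LINT y|lborel. K u y) = G u * (LINT y|lborel. iexp ((u - v) * y) * of_real (?e n y))"
        by (simp only: K_def mult.assoc integral_mult_right_zero)
      then show "(LINT y|lborel. K u y) = G u * of_real (real (Suc n) * sqrt (2 * pi) * exp (- (real (Suc n) * (u - v))\<^sup>2 / 2))"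
        using gaussian_fourier_transform(2)[of "real (Suc n)" "u - v"] by simp
    qed
    finally show ?thesis .
  qed
  have "A \<longlonglongrightarrow> 2 * of_real pi * G v"
    using gaussian_approximate_identity[OF G cont] unfolding Aeq[symmetric] .
  from LIMSEQ_unique[OF this lim1] have "2 * of_real pi * G v = (LINT y|lborel. H y * iexp (- (y * v)))" .
  then show ?thesis by (simp add: H_def field_simps)
qed

section \<open>Mellin inversion\<close>

lemma integral_exp_substitution:
  fixes g :: "real \<Rightarrow> complex"
  assumes g: "set_integrable lborel {0<..} g"
  shows "integrable lborel (\<lambda>u. exp u *\<^sub>R g (exp u))"
    and "(LINT u|lborel. exp u *\<^sub>R g (exp u)) = (LBINT t:{0<..}. g t)"
proof -
  have [measurable]: "(\<lambda>t. indicator {0<..} t *\<^sub>R g t) \<in> borel_measurable borel"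
    using g unfolding set_integrable_def by (simp add: borel_measurable_integrable)
  have "(\<lambda>u. exp u *\<^sub>R (indicator {0<..} (exp u) *\<^sub>R g (exp u))) \<in> borel_measurable borel"
    using measurable_compose[OF borel_measurable_exp, of "\<lambda>t. indicator {0<..} t *\<^sub>R g t" borel] by simp
  then have m: "(\<lambda>u. exp u *\<^sub>R g (exp u)) \<in> borel_measurable lborel" by simp
  have "g absolutely_integrable_on {0<..}"
    using g unfolding set_integrable_def by (simp add: integrable_completion)
  moreover have "range (exp :: real \<Rightarrow> real) = {0<..}"
    by (auto simp: image_iff intro: exp_ln[symmetric])
  moreover have "(\<lambda>x. \<bar>exp x\<bar> *\<^sub>R g (exp x)) absolutely_integrable_on UNIV \<and>
      integral UNIV (\<lambda>x. \<bar>exp x\<bar> *\<^sub>R g (exp x)) = integral {0<..} g \<longleftrightarrow>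
      g absolutely_integrable_on range exp \<and> integral (range exp) g = integral {0<..} g"
    by (rule has_absolute_integral_change_of_variables_real) (auto intro!: DERIV_exp simp: inj_on_def)
  ultimately have *: "(\<lambda>u. exp u *\<^sub>R g (exp u)) absolutely_integrable_on UNIV"
      "integral UNIV (\<lambda>u. exp u *\<^sub>R g (exp u)) = integral {0<..} g"
    by auto
  show int: "integrable lborel (\<lambda>u. exp u *\<^sub>R g (exp u))"
    using *(1) m by (simp add: set_integrable_def integrable_completion)
  show "(LINT u|lborel. exp u *\<^sub>R g (exp u)) = (LBINT t:{0<..}. g t)"
    using set_borel_integral_eq_integral(2)[OF g] *(2)
      set_borel_integral_eq_integral(2)[of UNIV "\<lambda>u. exp u *\<^sub>R g (exp u)"] int
    by (simp add: set_integrable_def set_lebesgue_integral_def)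
qed

text \<open>
  With \<open>t = e\<^sup>u\<close>, the Mellin transform on the line \<open>Re s = \<sigma>\<close> is the Fourier transform of
  \<open>e\<^sup>\<sigma>\<^sup>u g(e\<^sup>u)\<close>.
\<close>

theorem mellin_inversion:
  assumes t: "t > 0" and cont: "continuous_on {0<..} g"
    and g: "set_integrable lborel {0<..} (\<lambda>t. of_real (t powr (\<sigma> - 1)) * g t)"
    and M: "vline_integrable \<sigma> (mellin g)"
  shows "g t = 1 / (2 * of_real pi) *
           (LINT y|lborel. mellin g (Complex \<sigma> y) * of_real t powr (- Complex \<sigma> y))"
proof -
  define G where "G u = of_real (exp (\<sigma> * u)) * g (exp u)" for u
  have p: "of_real (exp u) powr (Complex \<sigma> y - 1) = of_real (exp ((\<sigma> - 1) * u)) * iexp (y * u)" for u y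
    by (subst of_real_powr_exp) (simp_all add: Complex_eq exp_of_real[symmetric] exp_add[symmetric] algebra_simps)
  have Geq: "G u = exp u *\<^sub>R (of_real ((exp u) powr (\<sigma> - 1)) * g (exp u))" for u
  proof -
    have "exp u * exp u powr (\<sigma> - 1) = exp (\<sigma> * u)"
      by (simp add: powr_def exp_add[symmetric] algebra_simps)
    then show ?thesis unfolding G_def by (simp add: scaleR_conv_of_real flip: of_real_mult mult.assoc)
  qed
  have "integrable lborel G"
    unfolding Geq by (rule integral_exp_substitution(1)[OF g])
  moreover have "isCont G (ln t)"
  proof -
    have "continuous_on UNIV (\<lambda>u :: real. g (exp u))"
      by (rule continuous_on_compose2[OF cont]) (auto intro!: continuous_intros)
    then have "continuous_on UNIV G"
      unfolding G_def by (intro continuous_intros)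
    then show ?thesis by (simp add: continuous_on_eq_continuous_at)
  qed
  moreover have mel: "(LINT u|lborel. G u * iexp (y * u)) = mellin g (Complex \<sigma> y)" for y
  proof -
    have gm: "(\<lambda>t. indicator {0<..} t *\<^sub>R (of_real (t powr (\<sigma> - 1)) * g t)) \<in> borel_measurable borel"
      using g unfolding set_integrable_def by (simp add: borel_measurable_integrable)
    have eq: "of_real t powr (Complex \<sigma> y - 1) * g t
        = of_real (t powr (\<sigma> - 1)) * g t * iexp (y * ln t)" if "t > 0" for t
      using p[of "ln t" y] that by (simp add: powr_def mult_ac)
    have "set_integrable lborel {0<..} (\<lambda>t. of_real t powr (Complex \<sigma> y - 1) * g t)"
      unfolding set_integrable_def
    proof (rule Bochner_Integration.integrable_bound[OF g[unfolded set_integrable_def]])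
      have E: "(\<lambda>t. indicator {0<..} t *\<^sub>R (of_real t powr (Complex \<sigma> y - 1) * g t))
          = (\<lambda>t. indicator {0<..} t *\<^sub>R (of_real (t powr (\<sigma> - 1)) * g t) * iexp (y * ln t))"
      proof
        fix t show "indicator {0<..} t *\<^sub>R (of_real t powr (Complex \<sigma> y - 1) * g t)
          = indicator {0<..} t *\<^sub>R (of_real (t powr (\<sigma> - 1)) * g t) * iexp (y * ln t)"
          using eq[of t] by (cases "t > 0") auto
      qed
      show "(\<lambda>t. indicator {0<..} t *\<^sub>R (of_real t powr (Complex \<sigma> y - 1) * g t)) \<in> borel_measurable lborel"
        unfolding E using gm by measurable
      show "AE t in lborel. norm (indicator {0<..} t *\<^sub>R (of_real t powr (Complex \<sigma> y - 1) * g t))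
          \<le> norm (indicator {0<..} t *\<^sub>R (of_real (t powr (\<sigma> - 1)) * g t))"
      proof (rule AE_I2)
        fix t show "norm (indicator {0<..} t *\<^sub>R (of_real t powr (Complex \<sigma> y - 1) * g t))
          \<le> norm (indicator {0<..} t *\<^sub>R (of_real (t powr (\<sigma> - 1)) * g t))"
          by (cases "t > 0") (simp_all add: norm_mult norm_powr_real_powr)
      qed
    qed
    from integral_exp_substitution(2)[OF this]
    have "mellin g (Complex \<sigma> y) = (LINT u|lborel. exp u *\<^sub>R (of_real (exp u) powr (Complex \<sigma> y - 1) * g (exp u)))"
      by (simp add: mellin_def)
    also have "\<dots> = (LINT u|lborel. G u * iexp (y * u))"
      by (rule Bochner_Integration.integral_cong[OF refl], subst eq) (simp_all add: Geq)
    finally show ?thesis ..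
  qed
  ultimately have "G (ln t) = 1 / (2 * of_real pi) * (LINT y|lborel. mellin g (Complex \<sigma> y) * iexp (- (y * ln t)))"
    using fourier_inversion[of G "ln t"] M by (simp only: mel vline_integrable_def)
  moreover have "g t = of_real (exp (- \<sigma> * ln t)) * G (ln t)"
    using t by (simp add: G_def mult.assoc[symmetric] exp_add[symmetric] flip: of_real_mult)
  moreover have "mellin g (Complex \<sigma> y) * of_real t powr (- Complex \<sigma> y)
      = of_real (exp (- \<sigma> * ln t)) * (mellin g (Complex \<sigma> y) * iexp (- (y * ln t)))" for y
    using t by (simp add: of_real_powr_exp Complex_eq exp_of_real[symmetric] exp_add[symmetric] algebra_simps)
  ultimately show ?thesis
    by (simp only: integral_mult_right_zero) (rule mult.left_commute)
qed

section \<open>Injectivity of the Laplace transform\<close>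

text \<open>
  With \<open>W(x) = e\<^sup>-\<^sup>x \<psi>(x)\<close>, the integrals of \<open>e\<^sup>-\<^sup>n\<^sup>x W(x)\<close> vanish for every natural number \<open>n\<close>, hence so does
  the integral of \<open>P(e\<^sup>-\<^sup>x) W(x)\<close> for a polynomial \<open>P\<close>, and by uniform approximation on
  \<open>[0, 1]\<close> also that of \<open>q(e\<^sup>-\<^sup>x) W(x)\<close> for continuous \<open>q\<close>. If \<open>\<psi>\<close> were positive at \<open>x0\<close>, a bump \<open>q\<close>
  concentrated near \<open>exp (- x0)\<close> would give a positive integral.
\<close>

lemma laplace_zero_imp_nonpos:
  fixes \<psi> :: "real \<Rightarrow> real"
  assumes cont: "continuous_on {0<..} \<psi>"
    and int: "\<And>p. p > 0 \<Longrightarrow> set_integrable lborel {0<..} (\<lambda>x. exp (- (p * x)) * \<psi> x)"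
    and zero: "\<And>p. p > 0 \<Longrightarrow> (LBINT x:{0<..}. exp (- (p * x)) * \<psi> x) = 0"
    and x0: "x0 > 0"
  shows "\<psi> x0 \<le> 0"
proof (rule ccontr)
  assume "\<not> \<psi> x0 \<le> 0"
  then have pos: "\<psi> x0 > 0" by simp
  define W where "W = (\<lambda>x. indicator {0<..} x *\<^sub>R (exp (- x) * \<psi> x))"
  have W: "integrable lborel W"
    using int[of 1] by (simp add: W_def set_integrable_def)
  then have [measurable]: "W \<in> borel_measurable lborel" by simp
  have mom: "integrable lborel (\<lambda>x. exp (- x) ^ i * W x)" "(LINT x|lborel. exp (- x) ^ i * W x) = 0" for i
  proof -
    have "exp (- x) ^ i * W x = indicator {0<..} x *\<^sub>R (exp (- (real (Suc i) * x)) * \<psi> x)" for x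
      by (simp add: W_def indicator_def exp_of_nat_mult[symmetric] exp_add[symmetric] algebra_simps)
    then show "integrable lborel (\<lambda>x. exp (- x) ^ i * W x)" "(LINT x|lborel. exp (- x) ^ i * W x) = 0"
      using int[of "real (Suc i)"] zero[of "real (Suc i)"]
      by (simp_all add: set_integrable_def set_lebesgue_integral_def del: of_nat_Suc)
  qed
  from cont x0 have "isCont \<psi> x0"
    by (simp add: continuous_on_eq_continuous_at)
  then obtain d where d: "d > 0" and dpos: "\<And>x. \<bar>x - x0\<bar> < d \<Longrightarrow> \<psi> x > 0"
  proof -
    from \<open>isCont \<psi> x0\<close> pos have "\<forall>\<^sub>F x in nhds x0. \<psi> x > 0"
      by (intro order_tendstoD(1)[of \<psi> "\<psi> x0"]) (auto simp: isCont_def tendsto_at_iff_tendsto_nhds)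
    then show ?thesis using that unfolding eventually_nhds_metric by (auto simp: dist_real_def)
  qed
  \<comment> \<open>As a function of \<open>u = exp (- x)\<close>, this bump is positive exactly for \<open>|x - x0| < d\<close>.\<close>
  define q where "q u = max 0 ((u - exp (- (x0 + d))) * (exp (- (x0 - d)) - u))" for u :: real
  have qpos: "q (exp (- x)) > 0" if "\<bar>x - x0\<bar> < d" for x
  proof -
    have "exp (- (x0 + d)) < exp (- x)" "exp (- x) < exp (- (x0 - d))" using that by auto
    then show ?thesis by (simp add: q_def less_max_iff_disj)
  qed
  have qzero: "q (exp (- x)) = 0" if "\<not> \<bar>x - x0\<bar> < d" for x
  proof -
    have "exp (- x) \<le> exp (- (x0 + d)) \<or> exp (- (x0 - d)) \<le> exp (- x)" using that by auto
    moreover have "exp (- (x0 + d)) \<le> exp (- (x0 - d))" using d by simp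
    ultimately show ?thesis unfolding q_def
      by (intro max_absorb1) (auto intro: mult_nonpos_nonneg mult_nonneg_nonpos)
  qed
  have q0: "q u \<ge> 0" for u by (simp add: q_def)
  have qcont: "continuous_on A q" for A unfolding q_def by (intro continuous_intros)
  have [measurable]: "q \<in> borel_measurable borel" using qcont by (rule borel_measurable_continuous_onI)
  have qW0: "q (exp (- x)) * W x \<ge> 0" for x
    using q0[of "exp (- x)"] qzero[of x] dpos[of x] by (cases "\<bar>x - x0\<bar> < d") (auto simp: W_def indicator_def intro!: mult_nonneg_nonneg less_imp_le)
  obtain B where B: "\<And>u. u \<in> {0..1} \<Longrightarrow> norm (q u) \<le> B"
    using compact_imp_bounded[OF compact_continuous_image[OF qcont compact_Icc]] unfolding bounded_iff by blast
  have qW: "integrable lborel (\<lambda>x. q (exp (- x)) * W x)"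
  proof (rule Bochner_Integration.integrable_bound[where f = "\<lambda>x. B * norm (W x)"])
    show "AE x in lborel. norm (q (exp (- x)) * W x) \<le> norm (B * norm (W x))"
    proof (rule AE_I2)
      fix x show "norm (q (exp (- x)) * W x) \<le> norm (B * norm (W x))"
        using B[of "exp (- x)"] B[of 0]
        by (cases "x > 0") (auto simp: abs_mult W_def intro!: mult_right_mono)
    qed
  qed (use W in auto)
  have "(LINT x|lborel. q (exp (- x)) * W x) = 0"
  proof -
    have "(LINT x|lborel. q (exp (- x)) * W x) \<le> e * (LINT x|lborel. norm (W x))" if e: "e > 0" for e
    proof -
      obtain P where P: "real_polynomial_function P" "\<And>u. u \<in> {0..1} \<Longrightarrow> \<bar>q u - P u\<bar> < e"
        using Stone_Weierstrass_real_polynomial_function[OF compact_Icc qcont e] by blast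
      then obtain b n where Peq: "P = (\<lambda>u. \<Sum>i\<le>n. b i * u ^ i)"
        using real_polynomial_function_imp_sum by blast
      have PW: "P (exp (- x)) * W x = (\<Sum>i\<le>n. b i * (exp (- x) ^ i * W x))" for x
        by (simp add: Peq sum_distrib_right mult.assoc)
      have intP: "integrable lborel (\<lambda>x. P (exp (- x)) * W x)"
        unfolding PW by (intro Bochner_Integration.integrable_sum integrable_mult_right mom)
      have zP: "(LINT x|lborel. P (exp (- x)) * W x) = 0"
        unfolding PW by (subst Bochner_Integration.integral_sum) (simp_all add: mom)
      have "(LINT x|lborel. q (exp (- x)) * W x) = (LINT x|lborel. q (exp (- x)) * W x - P (exp (- x)) * W x)"
        using qW intP zP by simp
      also have "\<dots> \<le> (LINT x|lborel. e * norm (W x))"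
      proof (intro integral_mono Bochner_Integration.integrable_diff qW intP)
        fix x
        have "\<bar>q (exp (- x)) - P (exp (- x))\<bar> * \<bar>W x\<bar> \<le> e * \<bar>W x\<bar>"
          using P(2)[of "exp (- x)"] by (cases "x > 0") (auto simp: W_def intro!: mult_right_mono)
        then show "q (exp (- x)) * W x - P (exp (- x)) * W x \<le> e * norm (W x)"
          by (simp flip: left_diff_distrib abs_mult)
      qed (use W in auto)
      finally show ?thesis by simp
    qed
    then have "(LINT x|lborel. q (exp (- x)) * W x) \<le> 0"
      by (intro tendsto_lowerbound[where F = "at_right 0" and f = "\<lambda>e. e * (LINT x|lborel. norm (W x))"])
         (auto intro!: tendsto_eq_intros eventually_at_right_less simp: eventually_at_filter)
    moreover have "(LINT x|lborel. q (exp (- x)) * W x) \<ge> 0"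
      by (intro integral_nonneg_AE AE_I2 qW0)
    ultimately show ?thesis by simp
  qed
  then have "AE x in lborel. q (exp (- x)) * W x = 0"
    using integral_nonneg_eq_0_iff_AE[OF qW] qW0 by simp
  then have "AE x in lborel. x \<notin> {max 0 (x0 - d)<..<x0 + d}"
  proof eventually_elim
    case (elim x)
    show ?case
    proof
      assume "x \<in> {max 0 (x0 - d)<..<x0 + d}"
      then have "x > 0" "\<bar>x - x0\<bar> < d" by auto
      then show False using elim qpos[of x] dpos[of x] by (simp add: W_def)
    qed
  qed
  then have "emeasure lborel {max 0 (x0 - d)<..<x0 + d} = 0"
    using AE_iff_null_sets[of "{max 0 (x0 - d)<..<x0 + d}" lborel] by (metis null_setsD1 borel_open open_greaterThanLessThan sets_lborel)
  then show False using d x0 by (simp split: if_splits)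
qed

text \<open>
  The preceding lemma, applied to the four
  real functionals \<open>\<plusminus>Re\<close> and \<open>\<plusminus>Im\<close>, shows that each of them is nonpositive at \<open>\<phi> x\<close>.
\<close>

theorem laplace_transform_injective:
  fixes \<phi> :: "real \<Rightarrow> complex"
  assumes cont: "continuous_on {0<..} \<phi>"
    and int: "\<And>p. p > 0 \<Longrightarrow> set_integrable lborel {0<..} (\<lambda>x. of_real (exp (- (p * x))) * \<phi> x)"
    and zero: "\<And>p. p > 0 \<Longrightarrow> (LBINT x:{0<..}. of_real (exp (- (p * x))) * \<phi> x) = 0"
    and x: "x > 0"
  shows "\<phi> x = 0"
proof -
  have *: "L (\<phi> x) \<le> 0" if L: "bounded_linear L" for L :: "complex \<Rightarrow> real"
  proof (rule laplace_zero_imp_nonpos[where \<psi> = "\<lambda>x. L (\<phi> x)", OF _ _ _ x])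
    interpret L: bounded_linear L by fact
    show "continuous_on {0<..} (\<lambda>x. L (\<phi> x))"
      by (rule L.continuous_on[OF cont])
    fix p :: real assume p: "p > 0"
    have eq: "indicator {0<..} x *\<^sub>R (exp (- (p * x)) * L (\<phi> x))
        = L (indicator {0<..} x *\<^sub>R (of_real (exp (- (p * x))) * \<phi> x))" for x
      by (simp add: L.scaleR flip: scaleR_conv_of_real)
    show "set_integrable lborel {0<..} (\<lambda>x. exp (- (p * x)) * L (\<phi> x))"
      using int[OF p] integrable_bounded_linear[OF L] by (simp only: set_integrable_def eq)
    show "(LBINT x:{0<..}. exp (- (p * x)) * L (\<phi> x)) = 0"
      using integral_bounded_linear[OF L int[OF p, unfolded set_integrable_def]] zero[OF p]
      by (simp only: set_lebesgue_integral_def eq L.zero)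
  qed
  have "Re (\<phi> x) = 0" using *[OF bounded_linear_Re] *[OF bounded_linear_minus[OF bounded_linear_Re]] by simp
  moreover have "Im (\<phi> x) = 0" using *[OF bounded_linear_Im] *[OF bounded_linear_minus[OF bounded_linear_Im]] by simp
  ultimately show ?thesis by (simp add: complex_eq_iff)
qed

section \<open>Inverse Mellin transforms and their Laplace transforms\<close>

lemma mellin_rep_formula:
  assumes "mellin_rep c f fs" "x > 0"
  shows "f x = 1 / (2 * of_real pi) *
           (LINT \<tau>|lborel. fs (Complex c \<tau>) * of_real x powr (- Complex c \<tau>))"
  using assms unfolding mellin_rep_def vline_integral_def by (simp add: field_simps)

lemma mellin_rep_line_integrable:
  "mellin_rep c f fs \<Longrightarrow> integrable lborel (\<lambda>\<tau>. fs (Complex c \<tau>))"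
  by (simp add: mellin_rep_def vline_integrable_def)

lemma mellin_rep_norm_le:
  assumes rep: "mellin_rep c f fs" and x: "x > 0"
  shows "norm (f x) \<le> vline_norm c fs / (2 * pi) * x powr (- c)"
proof -
  have "norm (LINT \<tau>|lborel. fs (Complex c \<tau>) * of_real x powr (- Complex c \<tau>))
      \<le> (LINT \<tau>|lborel. norm (fs (Complex c \<tau>) * of_real x powr (- Complex c \<tau>)))"
    by (rule integral_norm_bound)
  also have "\<dots> = vline_norm c fs * x powr (- c)"
    using x by (simp add: vline_norm_def norm_mult norm_powr_real_powr)
  finally show ?thesis
    using x by (simp add: mellin_rep_formula[OF rep x] norm_mult norm_divide field_simps)
qed

lemma continuous_on_mellin_rep:
  assumes rep: "mellin_rep c f fs"
  shows "continuous_on {0<..} f"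
proof -
  have int: "integrable lborel (\<lambda>\<tau>. fs (Complex c \<tau>))"
    by (rule mellin_rep_line_integrable[OF rep])
  then have [measurable]: "(\<lambda>\<tau>. fs (Complex c \<tau>)) \<in> borel_measurable lborel" by simp
  have "continuous_on {0<..} (\<lambda>x. LINT \<tau>|lborel. fs (Complex c \<tau>) * of_real x powr (- Complex c \<tau>))"
  proof (rule continuous_on_integral_dominated[where B = "\<lambda>x. x powr (- c)" and w = "\<lambda>\<tau>. norm (fs (Complex c \<tau>))"])
    show "continuous_on {0<..} (\<lambda>x :: real. x powr (- c))"
      by (intro continuous_intros) auto
    show "continuous_on {0<..} (\<lambda>x. fs (Complex c \<tau>) * of_real x powr (- Complex c \<tau>))" for \<tau>
      by (intro continuous_intros) auto
  qed (use int in \<open>auto simp: norm_mult norm_powr_real_powr\<close>)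
  then have "continuous_on {0<..} (\<lambda>x. 1 / (2 * of_real pi) *
      (LINT \<tau>|lborel. fs (Complex c \<tau>) * of_real x powr (- Complex c \<tau>)))"
    by (intro continuous_intros)
  then show ?thesis
    by (rule continuous_on_eq) (simp add: mellin_rep_formula[OF rep])
qed

lemma set_borel_measurable_continuous_pos:
  fixes f :: "real \<Rightarrow> complex"
  assumes "continuous_on {0<..} f"
  shows "(\<lambda>x. indicator {0<..} x *\<^sub>R f x) \<in> borel_measurable borel"
  using assms by (intro borel_measurable_continuous_on_indicator) auto

definition laplace :: "(real \<Rightarrow> complex) \<Rightarrow> real \<Rightarrow> complex" where
  "laplace f p = (LBINT x:{0<..}. of_real (exp (- (p * x))) * f x)"

lemma laplace_integrable:
  assumes c: "c < 1" and rep: "mellin_rep c f fs" and p: "p > 0"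
  shows "set_integrable lborel {0<..} (\<lambda>x. of_real (exp (- (p * x))) * f x)"
    and "(LBINT x:{0<..}. norm (of_real (exp (- (p * x))) * f x))
           \<le> vline_norm c fs / (2 * pi) * (Gamma (1 - c) * p powr (c - 1))"
proof -
  define N where "N = vline_norm c fs / (2 * pi)"
  have le: "norm (of_real (exp (- (p * x))) * f x) \<le> N * (exp (- (p * x)) * x powr ((1 - c) - 1))" if "x > 0" for x
    using mult_left_mono[OF mellin_rep_norm_le[OF rep that], of "exp (- (p * x))"]
    by (simp add: norm_mult N_def mult_ac)
  have bd: "set_integrable lborel {0<..} (\<lambda>x. N * (exp (- (p * x)) * x powr ((1 - c) - 1)))"
    using Gamma_integral_scaled_real(1)[of "1 - c" p] c p by (intro set_integrable_mult_right) auto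
  have [measurable]: "(\<lambda>x. indicator {0<..} x *\<^sub>R f x) \<in> borel_measurable borel"
    by (rule set_borel_measurable_continuous_pos[OF continuous_on_mellin_rep[OF rep]])
  have "(\<lambda>x. of_real (exp (- (p * x))) * (indicator {0<..} x *\<^sub>R f x)) \<in> borel_measurable borel"
    by measurable
  then have m: "(\<lambda>x. indicator {0<..} x *\<^sub>R (of_real (exp (- (p * x))) * f x)) \<in> borel_measurable lborel"
    by simp
  show int: "set_integrable lborel {0<..} (\<lambda>x. of_real (exp (- (p * x))) * f x)"
    by (rule set_integrable_bound[OF bd]) (use m order_trans[OF le abs_ge_self] in \<open>auto simp: set_borel_measurable_def\<close>)
  have "(LBINT x:{0<..}. norm (of_real (exp (- (p * x))) * f x))
      \<le> (LBINT x:{0<..}. N * (exp (- (p * x)) * x powr ((1 - c) - 1)))"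
    by (rule set_integral_mono[OF set_integrable_norm[OF int] bd]) (use le in auto)
  also have "\<dots> = N * (Gamma (1 - c) * p powr (- (1 - c)))"
    using Gamma_integral_scaled_real(2)[of "1 - c" p] c p by simp
  finally show "(LBINT x:{0<..}. norm (of_real (exp (- (p * x))) * f x))
           \<le> vline_norm c fs / (2 * pi) * (Gamma (1 - c) * p powr (c - 1))"
    by (simp add: N_def)
qed

lemma norm_Gamma_line_le:
  assumes "c < 1" shows "norm (Gamma (1 - Complex c \<tau>)) \<le> Gamma (1 - c)"
  using norm_Gamma_le[of "1 - Complex c \<tau>"] assms by simp

text \<open>
  Taking the Laplace transform under the integral over the line replaces \<open>x powr (-s)\<close> by its Laplace
  transform \<open>\<Gamma>(1 - s) p powr (s - 1)\<close>.
\<close>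

lemma laplace_mellin_rep:
  assumes c: "c < 1" and rep: "mellin_rep c f fs" and p: "p > 0"
  shows "laplace f p = 1 / (2 * of_real pi) *
           (LINT \<tau>|lborel. fs (Complex c \<tau>) * Gamma (1 - Complex c \<tau>) * of_real p powr (Complex c \<tau> - 1))"
proof -
  have int: "integrable lborel (\<lambda>\<tau>. fs (Complex c \<tau>))"
    by (rule mellin_rep_line_integrable[OF rep])
  then have [measurable]: "(\<lambda>\<tau>. fs (Complex c \<tau>)) \<in> borel_measurable lborel" by simp
  define g where "g \<tau> x = indicator {0<..} x *\<^sub>R (of_real (exp (- (p * x))) * of_real x powr (- Complex c \<tau>))" for \<tau> x
  have g: "integrable lborel (g \<tau>)" "integral\<^sup>L lborel (g \<tau>) = Gamma (1 - Complex c \<tau>) * of_real p powr (Complex c \<tau> - 1)" for \<tau>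
    using Gamma_integral_scaled[of "1 - Complex c \<tau>" p] c p
    by (simp_all add: g_def[abs_def] set_integrable_def set_lebesgue_integral_def)
  have gn: "(LINT x|lborel. norm (g \<tau> x)) = Gamma (1 - c) * p powr (- (1 - c))" for \<tau>
  proof -
    have "norm (g \<tau> x) = indicator {0<..} x *\<^sub>R (exp (- (p * x)) * x powr ((1 - c) - 1))" for x
      by (cases "x > 0") (simp_all add: g_def norm_mult norm_powr_real_powr)
    then show ?thesis
      using Gamma_integral_scaled_real(2)[of "1 - c" p] c p by (simp add: set_lebesgue_integral_def)
  qed
  define K where "K \<tau> x = fs (Complex c \<tau>) * g \<tau> x" for \<tau> x
  have Kint: "integrable (lborel \<Otimes>\<^sub>M lborel) (case_prod K)"
  proof (rule integrable_pair_bounded_sections(1))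
    show "case_prod K \<in> borel_measurable (lborel \<Otimes>\<^sub>M lborel)"
      unfolding K_def g_def case_prod_unfold by measurable
    show "integrable lborel (K \<tau>)" for \<tau>
      unfolding K_def[abs_def] by (rule integrable_mult_right[OF g(1)])
    show "(LINT x|lborel. norm (K \<tau> x)) \<le> norm (fs (Complex c \<tau>)) * (Gamma (1 - c) * p powr (- (1 - c)))" for \<tau>
      by (simp add: K_def norm_mult gn)
  qed (use int in simp)
  have "laplace f p = (LINT x|lborel. 1 / (2 * of_real pi) * (LINT \<tau>|lborel. K \<tau> x))"
    unfolding laplace_def set_lebesgue_integral_def
  proof (rule Bochner_Integration.integral_cong[OF refl])
    fix x
    show "indicator {0<..} x *\<^sub>R (of_real (exp (- (p * x))) * f x) = 1 / (2 * of_real pi) * (LINT \<tau>|lborel. K \<tau> x)"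
    proof (cases "x > 0")
      case True
      have "K \<tau> x = of_real (exp (- (p * x))) * (fs (Complex c \<tau>) * of_real x powr (- Complex c \<tau>))" for \<tau>
        using True by (simp add: K_def g_def mult_ac)
      then have "(LINT \<tau>|lborel. K \<tau> x) = of_real (exp (- (p * x))) * (LINT \<tau>|lborel. fs (Complex c \<tau>) * of_real x powr (- Complex c \<tau>))"
        by (simp only: integral_mult_right_zero)
      then show ?thesis using True mellin_rep_formula[OF rep True] by simp
    qed (simp add: K_def g_def)
  qed
  also have "\<dots> = 1 / (2 * of_real pi) * (LINT \<tau>|lborel. LINT x|lborel. K \<tau> x)"
    by (simp only: integral_mult_right_zero lborel_pair.Fubini_integral[OF Kint])
  also have "(\<lambda>\<tau>. LINT x|lborel. K \<tau> x)
      = (\<lambda>\<tau>. fs (Complex c \<tau>) * Gamma (1 - Complex c \<tau>) * of_real p powr (Complex c \<tau> - 1))"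
    by (simp add: K_def g(2) mult.assoc)
  finally show ?thesis .
qed

lemma continuous_on_laplace_mellin_rep:
  assumes c: "c < 1" and rep: "mellin_rep c f fs"
  shows "continuous_on {0<..} (laplace f)"
proof -
  have int: "integrable lborel (\<lambda>\<tau>. fs (Complex c \<tau>))"
    by (rule mellin_rep_line_integrable[OF rep])
  then have [measurable]: "(\<lambda>\<tau>. fs (Complex c \<tau>)) \<in> borel_measurable lborel" by simp
  let ?K = "\<lambda>p \<tau>. fs (Complex c \<tau>) * Gamma (1 - Complex c \<tau>) * of_real p powr (Complex c \<tau> - 1)"
  have "continuous_on {0<..} (\<lambda>p. LINT \<tau>|lborel. ?K p \<tau>)"
  proof (rule continuous_on_integral_dominated[where B = "\<lambda>p. Gamma (1 - c) * p powr (c - 1)" and w = "\<lambda>\<tau>. norm (fs (Complex c \<tau>))"])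
    show "continuous_on {0<..} (\<lambda>p :: real. Gamma (1 - c) * p powr (c - 1))"
      by (intro continuous_intros) auto
    show "continuous_on {0<..} (\<lambda>p. ?K p \<tau>)" for \<tau>
      by (intro continuous_intros) auto
    show "norm (?K p \<tau>) \<le> Gamma (1 - c) * p powr (c - 1) * norm (fs (Complex c \<tau>))" if "p \<in> {0<..}" for p \<tau>
      using that mult_left_mono[OF norm_Gamma_line_le[OF c, of \<tau>], of "p powr (c - 1) * norm (fs (Complex c \<tau>))"]
      by (simp add: norm_mult norm_powr_real_powr mult_ac)
  qed (use int in auto)
  then have "continuous_on {0<..} (\<lambda>p. 1 / (2 * of_real pi) * (LINT \<tau>|lborel. ?K p \<tau>))"
    by (intro continuous_intros)
  then show ?thesis
    by (rule continuous_on_eq) (simp add: laplace_mellin_rep[OF c rep])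
qed

section \<open>The transformation F on a vertical line\<close>

locale mellin_kernel =
  fixes c0 \<gamma> :: real and a :: "nat \<Rightarrow> complex" and r :: "real \<Rightarrow> complex"
    and \<rho> :: "complex \<Rightarrow> complex"
  assumes c0: "c0 < 1"
    and radius: "conv_radius a = \<infinity>"
    and r_eq: "\<And>t. r t = (\<Sum>k. a k * of_real t ^ k)"
    and r_nz: "\<And>t. t > 0 \<Longrightarrow> r t \<noteq> 0"
    and weight: "set_integrable lborel {0<..} (\<lambda>t. of_real (t powr (\<gamma> - c0)) * (1 / r t))"
    and rho_eq: "\<And>s. \<rho> s = mellin (\<lambda>t. 1 / r t) s"
    and rho_int: "vline_integrable (1 + \<gamma> - c0) \<rho>"
begin

lemma summable_coeffs: "x \<ge> 0 \<Longrightarrow> summable (\<lambda>k. norm (a k) * x ^ k)"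
  using abs_summable_in_conv_radius[of "complex_of_real x" a] by (simp add: radius norm_mult norm_power)

lemma continuous_on_r: "continuous_on UNIV r"
  using continuous_on_entire_power_series[OF summable_coeffs] by (simp add: r_eq[abs_def])

lemma r_measurable [measurable]: "r \<in> borel_measurable borel"
  using continuous_on_r by (rule borel_measurable_continuous_onI)

lemma r_sums: "(\<lambda>k. a k * of_real t ^ k) sums r t"
proof -
  have "summable (\<lambda>k. a k * of_real t ^ k)"
    by (rule summable_norm_cancel) (use summable_coeffs[of "\<bar>t\<bar>"] in \<open>simp add: norm_mult norm_power\<close>)
  then show ?thesis by (simp add: r_eq summable_sums)
qed

lemma weight_norm: "integrable lborel (\<lambda>t. indicator {0<..} t *\<^sub>R (t powr (\<gamma> - c0) / norm (r t)))"
proof -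
  have "norm (of_real (t powr (\<gamma> - c0)) * (1 / r t)) = t powr (\<gamma> - c0) / norm (r t)" for t
    by (simp add: norm_mult norm_divide)
  then show ?thesis using set_integrable_norm[OF weight] by (simp add: set_integrable_def)
qed

text \<open>
  Near \<open>t = 0\<close> the exponential compensates: \<open>e\<^sup>-\<^sup>x\<^sup>/\<^sup>t\<close> is bounded by a constant times
  \<open>t powr (1 - c0)\<close>, which reduces the integrand to the weight.
\<close>

lemma kminus_integrable:
  assumes z: "Re z = \<gamma>" and x: "x > 0"
  shows "set_integrable lborel {0<..} (kminus_integrand r z x)"
  unfolding set_integrable_def
proof (rule Bochner_Integration.integrable_bound)
  define b where "b = 1 - c0"
  have b: "b > 0" using c0 by (simp add: b_def)
  define C where "C = b powr b * x powr (- b)"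
  show "integrable lborel (\<lambda>t. C * (indicator {0<..} t *\<^sub>R (t powr (\<gamma> - c0) / norm (r t))))"
    by (intro integrable_mult_right weight_norm)
  show "(\<lambda>t. indicator {0<..} t *\<^sub>R kminus_integrand r z x t) \<in> borel_measurable lborel"
    unfolding kminus_integrand_def by measurable
  have bound: "exp (- x / t) * t powr (\<gamma> - 1) \<le> C * t powr (\<gamma> - c0)" if t: "t > 0" for t
  proof -
    have "(x / t / b) powr b \<le> exp (x / t / b) powr b"
      \<comment> \<open>With \<open>u = x / t\<close>: raising \<open>u / b \<le> exp (u / b)\<close> to the power \<open>b\<close> gives \<open>u powr b \<le> b powr b * exp u\<close>.\<close>
      using b x t order_trans[OF _ exp_ge_add_one_self, of "x / t / b" "x / t / b"] by (intro powr_mono2) auto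
    then have "(x / t) powr b \<le> b powr b * exp (x / t)"
      using b x t by (simp add: powr_divide powr_mult powr_def[of "exp _"] field_simps)
    then have "exp (- x / t) * x powr b \<le> b powr b * t powr b"
      using x t by (simp add: powr_divide exp_minus field_simps)
    then have "exp (- x / t) \<le> C * t powr b"
      using x by (simp add: C_def powr_minus field_simps)
    from mult_right_mono[OF this, of "t powr (\<gamma> - 1)"] show ?thesis
      by (simp add: b_def mult.assoc flip: powr_add)
  qed
  show "AE t in lborel. norm (indicator {0<..} t *\<^sub>R kminus_integrand r z x t)
      \<le> norm (C * (indicator {0<..} t *\<^sub>R (t powr (\<gamma> - c0) / norm (r t))))"
  proof (rule AE_I2)
    fix t
    have C0: "C \<ge> 0" by (simp add: C_def)
    show "norm (indicator {0<..} t *\<^sub>R kminus_integrand r z x t)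
      \<le> norm (C * (indicator {0<..} t *\<^sub>R (t powr (\<gamma> - c0) / norm (r t))))"
    proof (cases "t > 0")
      case True
      then show ?thesis
        using divide_right_mono[OF bound[OF True], of "norm (r t)"] z C0
        by (simp add: kminus_integrand_def norm_mult norm_divide norm_powr_real_powr)
    qed simp
  qed
qed

text \<open>
  For fixed \<open>t\<close>, the integral over \<open>x\<close> of \<open>e\<^sup>-\<^sup>x\<^sup>/\<^sup>t |f(x)|\<close> is at most a constant times
  \<open>t powr (1 - c0)\<close>, so the double integral is dominated by the weight and the order of
  integration may be exchanged.
\<close>

lemma Ftrans_eq_mellin:
  assumes rep: "mellin_rep c0 f fs" and z: "Re z = \<gamma>"
  shows "set_integrable lborel {0<..} (\<lambda>x. kminus r z x * f x)"
    and "Ftrans r f z = mellin (\<lambda>t. laplace f (1 / t) / r t) z"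
    and "set_integrable lborel {0<..} (\<lambda>t. of_real t powr (z - 1) * (laplace f (1 / t) / r t))"
proof -
  have fm [measurable]: "(\<lambda>x. indicator {0<..} x *\<^sub>R f x) \<in> borel_measurable borel"
    by (rule set_borel_measurable_continuous_pos[OF continuous_on_mellin_rep[OF rep]])
  define N where "N = vline_norm c0 fs / (2 * pi)"
  define q where "q t = indicator {0<..} t *\<^sub>R (of_real t powr (z - 1) / r t)" for t
  define e where "e t x = indicator {0<..} x *\<^sub>R (of_real (exp (- (1 / t * x))) * f x)" for t x
  define K where "K t x = q t * e t x" for t x
  have e: "integrable lborel (e t)" "(LINT x|lborel. norm (e t x)) \<le> N * (Gamma (1 - c0) * t powr (1 - c0))"
    "integral\<^sup>L lborel (e t) = laplace f (1 / t)" if "t > 0" for t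
  proof -
    show "integrable lborel (e t)"
      using laplace_integrable(1)[OF c0 rep, of "1 / t"] that by (simp add: e_def[abs_def] set_integrable_def)
    have "(LINT x|lborel. norm (e t x)) = (LBINT x:{0<..}. norm (of_real (exp (- (1 / t * x))) * f x))"
      unfolding set_lebesgue_integral_def e_def by (rule Bochner_Integration.integral_cong) (simp_all add: indicator_def)
    also have "\<dots> \<le> N * (Gamma (1 - c0) * (1 / t) powr (c0 - 1))"
      unfolding N_def by (rule laplace_integrable(2)[OF c0 rep]) (use that in simp)
    also have "(1 / t) powr (c0 - 1) = t powr (1 - c0)"
      using that by (simp add: powr_divide powr_minus_divide[symmetric])
    finally show "(LINT x|lborel. norm (e t x)) \<le> N * (Gamma (1 - c0) * t powr (1 - c0))" .
    show "integral\<^sup>L lborel (e t) = laplace f (1 / t)"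
      by (simp add: e_def[abs_def] laplace_def set_lebesgue_integral_def)
  qed
  have K0: "K t = (\<lambda>x. 0)" if "\<not> t > 0" for t using that by (simp add: K_def q_def fun_eq_iff)
  have Kint: "integrable (lborel \<Otimes>\<^sub>M lborel) (case_prod K)"
  proof (rule integrable_pair_bounded_sections(1))
    have K_eq: "K = (\<lambda>t x. q t * (of_real (exp (- (1 / t * x))) * (indicator {0<..} x *\<^sub>R f x)))"
      by (simp add: K_def e_def fun_eq_iff)
    show "case_prod K \<in> borel_measurable (lborel \<Otimes>\<^sub>M lborel)"
      unfolding K_eq q_def case_prod_unfold by measurable
    show "integrable lborel (K t)" for t
      using e(1)[of t] K0[of t] by (cases "t > 0") (auto simp: K_def[abs_def])
    show "(LINT x|lborel. norm (K t x)) \<le> N * Gamma (1 - c0) * (indicator {0<..} t *\<^sub>R (t powr (\<gamma> - c0) / norm (r t)))" for t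
    proof (cases "t > 0")
      case True
      have "(LINT x|lborel. norm (K t x)) = norm (q t) * (LINT x|lborel. norm (e t x))"
        by (simp add: K_def norm_mult)
      also have "\<dots> \<le> norm (q t) * (N * (Gamma (1 - c0) * t powr (1 - c0)))"
        by (rule mult_left_mono[OF e(2)[OF True]]) simp
      also have "norm (q t) = t powr (\<gamma> - 1) / norm (r t)"
        using True z by (simp add: q_def norm_divide norm_powr_real_powr)
      also have "t powr (\<gamma> - 1) / norm (r t) * (N * (Gamma (1 - c0) * t powr (1 - c0)))
          = N * Gamma (1 - c0) * (t powr ((\<gamma> - 1) + (1 - c0)) / norm (r t))"
        by (simp only: powr_add) (simp add: mult_ac)
      finally show ?thesis using True by simp
    qed (simp add: K0)
    show "integrable lborel (\<lambda>t. N * Gamma (1 - c0) * (indicator {0<..} t *\<^sub>R (t powr (\<gamma> - c0) / norm (r t))))"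
      by (intro integrable_mult_right weight_norm)
  qed
  have snd: "(LINT t|lborel. K t x) = indicator {0<..} x *\<^sub>R (kminus r z x * f x)" for x
  proof -
    have "K t x = (indicator {0<..} t *\<^sub>R kminus_integrand r z x t) * (indicator {0<..} x *\<^sub>R f x)" for t
      by (simp add: K_def q_def e_def kminus_integrand_def divide_inverse mult_ac)
    then have "(LINT t|lborel. K t x) = kminus r z x * (indicator {0<..} x *\<^sub>R f x)"
      by (simp only: integral_mult_left_zero kminus_def set_lebesgue_integral_def)
    then show ?thesis by simp
  qed
  have fst: "(LINT x|lborel. K t x) = indicator {0<..} t *\<^sub>R (of_real t powr (z - 1) * (laplace f (1 / t) / r t))" for t
  proof (cases "t > 0")
    case True
    have "(LINT x|lborel. K t x) = q t * laplace f (1 / t)"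
      using e(3)[OF True] by (simp add: K_def)
    then show ?thesis using True by (simp add: q_def)
  qed (simp add: K0)
  show "set_integrable lborel {0<..} (\<lambda>x. kminus r z x * f x)"
    using lborel_pair.integrable_snd[OF Kint] by (simp only: snd set_integrable_def)
  show "set_integrable lborel {0<..} (\<lambda>t. of_real t powr (z - 1) * (laplace f (1 / t) / r t))"
    using lborel_pair.integrable_fst[OF Kint] by (simp only: fst set_integrable_def)
  show "Ftrans r f z = mellin (\<lambda>t. laplace f (1 / t) / r t) z"
    using lborel_pair.Fubini_integral[OF Kint]
    by (simp only: snd fst Ftrans_def mellin_def set_lebesgue_integral_def)
qed

end

context mellin_kernel
begin

text \<open>
  Insert the line integral for \<open>L f (1/t)\<close> in the Mellin transform and exchange; the integral over \<open>t\<close>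
  of \<open>t powr (z - s) / r(t)\<close> is \<open>\<rho>(1 + z - s)\<close>.
\<close>

lemma Ftrans_line_formula:
  assumes rep: "mellin_rep c0 f fs" and z: "Re z = \<gamma>"
  shows "integrable lborel (\<lambda>\<tau>. fs (Complex c0 \<tau>) * Gamma (1 - Complex c0 \<tau>) * \<rho> (1 + z - Complex c0 \<tau>))"
    and "Ftrans r f z = 1 / (2 * of_real pi) *
           (LINT \<tau>|lborel. fs (Complex c0 \<tau>) * Gamma (1 - Complex c0 \<tau>) * \<rho> (1 + z - Complex c0 \<tau>))"
proof -
  have int: "integrable lborel (\<lambda>\<tau>. fs (Complex c0 \<tau>))"
    by (rule mellin_rep_line_integrable[OF rep])
  then have [measurable]: "(\<lambda>\<tau>. fs (Complex c0 \<tau>)) \<in> borel_measurable lborel" by simp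
  define q where "q t = indicator {0<..} t *\<^sub>R (of_real t powr (z - 1) / r t)" for t
  define g where "g t \<tau> = fs (Complex c0 \<tau>) * Gamma (1 - Complex c0 \<tau>) * of_real t powr (1 - Complex c0 \<tau>)" for t \<tau>
  define K where "K t \<tau> = q t * g t \<tau>" for t \<tau>
  have gm: "g t \<in> borel_measurable lborel" for t unfolding g_def[abs_def] by measurable
  have gn: "norm (g t \<tau>) \<le> t powr (1 - c0) * (Gamma (1 - c0) * norm (fs (Complex c0 \<tau>)))" if "t > 0" for t \<tau>
    using that mult_left_mono[OF norm_Gamma_line_le[OF c0, of \<tau>], of "t powr (1 - c0) * norm (fs (Complex c0 \<tau>))"]
    by (simp add: g_def norm_mult norm_powr_real_powr mult_ac)
  have gi: "integrable lborel (g t)" if "t > 0" for t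
    by (rule Bochner_Integration.integrable_bound[where f = "\<lambda>\<tau>. t powr (1 - c0) * (Gamma (1 - c0) * norm (fs (Complex c0 \<tau>)))"])
       (use int gm order_trans[OF gn[OF that] abs_ge_self] in \<open>auto intro!: AE_I2\<close>)
  have K0: "K t = (\<lambda>\<tau>. 0)" if "\<not> t > 0" for t using that by (simp add: K_def q_def fun_eq_iff)
  define N where "N = Gamma (1 - c0) * vline_norm c0 fs"
  have Kint: "integrable (lborel \<Otimes>\<^sub>M lborel) (case_prod K)"
  proof (rule integrable_pair_bounded_sections(1))
    show "case_prod K \<in> borel_measurable (lborel \<Otimes>\<^sub>M lborel)"
      unfolding K_def q_def g_def case_prod_unfold by measurable
    show "integrable lborel (K t)" for t
      using gi[of t] K0[of t] by (cases "t > 0") (auto simp: K_def[abs_def])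
    show "(LINT \<tau>|lborel. norm (K t \<tau>)) \<le> N * (indicator {0<..} t *\<^sub>R (t powr (\<gamma> - c0) / norm (r t)))" for t
    proof (cases "t > 0")
      case True
      have "(LINT \<tau>|lborel. norm (K t \<tau>)) = norm (q t) * (LINT \<tau>|lborel. norm (g t \<tau>))"
        by (simp add: K_def norm_mult)
      also have "(LINT \<tau>|lborel. norm (g t \<tau>)) \<le> (LINT \<tau>|lborel. t powr (1 - c0) * (Gamma (1 - c0) * norm (fs (Complex c0 \<tau>))))"
        by (intro integral_mono integrable_norm gi True gn integrable_mult_right int)
      also have "\<dots> = t powr (1 - c0) * N" by (simp add: N_def vline_norm_def)
      also have "norm (q t) = t powr (\<gamma> - 1) / norm (r t)"
        using True z by (simp add: q_def norm_divide norm_powr_real_powr)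
      also have "t powr (\<gamma> - 1) / norm (r t) * (t powr (1 - c0) * N)
          = N * (t powr ((\<gamma> - 1) + (1 - c0)) / norm (r t))"
        by (simp only: powr_add) (simp add: mult_ac)
      finally show ?thesis using True by (simp add: mult_left_mono)
    qed (simp add: K0)
    show "integrable lborel (\<lambda>t. N * (indicator {0<..} t *\<^sub>R (t powr (\<gamma> - c0) / norm (r t))))"
      by (intro integrable_mult_right weight_norm)
  qed
  have fst: "(LINT \<tau>|lborel. K t \<tau>) = 2 * of_real pi * (indicator {0<..} t *\<^sub>R (of_real t powr (z - 1) * (laplace f (1 / t) / r t)))" for t
  proof (cases "t > 0")
    case True
    have "of_real (1 / t) powr (Complex c0 \<tau> - 1) = of_real t powr (1 - Complex c0 \<tau>)" for \<tau>
      using True by (simp add: of_real_powr_exp ln_div algebra_simps del: of_real_divide)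
    then have "2 * of_real pi * laplace f (1 / t) = integral\<^sup>L lborel (g t)"
      using laplace_mellin_rep[OF c0 rep, of "1 / t"] True by (simp add: g_def[abs_def] del: of_real_divide)
    moreover have "(LINT \<tau>|lborel. K t \<tau>) = q t * integral\<^sup>L lborel (g t)"
      by (simp add: K_def)
    ultimately show ?thesis using True by (simp add: q_def mult_ac flip: \<open>_ = integral\<^sup>L lborel (g t)\<close>)
  qed (simp add: K0)
  have snd: "(LINT t|lborel. K t \<tau>) = fs (Complex c0 \<tau>) * Gamma (1 - Complex c0 \<tau>) * \<rho> (1 + z - Complex c0 \<tau>)" for \<tau>
  proof -
    have "K t \<tau> = fs (Complex c0 \<tau>) * Gamma (1 - Complex c0 \<tau>) *
        (indicator {0<..} t *\<^sub>R (of_real t powr ((1 + z - Complex c0 \<tau>) - 1) * (1 / r t)))" for t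
    proof (cases "t > 0")
      case True
      have "(1 + z - Complex c0 \<tau>) - 1 = (z - 1) + (1 - Complex c0 \<tau>)" by simp
      then show ?thesis using True by (simp only: powr_add) (simp add: K_def q_def g_def)
    qed (simp add: K_def q_def)
    then show ?thesis
      by (simp only: integral_mult_right_zero rho_eq mellin_def set_lebesgue_integral_def)
  qed
  show "integrable lborel (\<lambda>\<tau>. fs (Complex c0 \<tau>) * Gamma (1 - Complex c0 \<tau>) * \<rho> (1 + z - Complex c0 \<tau>))"
    using lborel_pair.integrable_snd[OF Kint] by (simp only: snd)
  have "2 * of_real pi * Ftrans r f z = (LINT t|lborel. LINT \<tau>|lborel. K t \<tau>)"
    by (simp only: fst integral_mult_right_zero Ftrans_eq_mellin(2)[OF rep z] mellin_def set_lebesgue_integral_def)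
  also have "\<dots> = (LINT \<tau>|lborel. LINT t|lborel. K t \<tau>)"
    by (rule lborel_pair.Fubini_integral[OF Kint, symmetric])
  finally show "Ftrans r f z = 1 / (2 * of_real pi) *
           (LINT \<tau>|lborel. fs (Complex c0 \<tau>) * Gamma (1 - Complex c0 \<tau>) * \<rho> (1 + z - Complex c0 \<tau>))"
    by (simp add: snd field_simps)
qed

text \<open>
  For \<open>z = \<gamma> + i y\<close> and \<open>s = c0 + i \<tau>\<close> the argument \<open>1 + z - s\<close> lies on the line
  \<open>Re = 1 + \<gamma> - c0\<close> at height \<open>y - \<tau>\<close>: the formula for \<open>F f\<close> is a convolution of two integrable
  functions.
\<close>

lemma Ftrans_bounded:
  assumes rep: "mellin_rep c0 f fs"
  shows "vline_integrable \<gamma> (Ftrans r f)"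
    and "vline_norm \<gamma> (Ftrans r f)
           \<le> Gamma (1 - c0) * vline_norm (1 + \<gamma> - c0) \<rho> * (1 / (2 * pi) * vline_norm c0 fs)"
proof -
  have int: "integrable lborel (\<lambda>\<tau>. fs (Complex c0 \<tau>))"
    by (rule mellin_rep_line_integrable[OF rep])
  then have [measurable]: "(\<lambda>\<tau>. fs (Complex c0 \<tau>)) \<in> borel_measurable lborel" by simp
  define R where "R y = \<rho> (Complex (1 + \<gamma> - c0) y)" for y
  have R: "integrable lborel R" using rho_int by (simp add: vline_integrable_def R_def[abs_def])
  then have [measurable]: "R \<in> borel_measurable borel" by (simp add: borel_measurable_integrable)
  have Rs: "integrable lborel (\<lambda>y. R (y - \<tau>))" for \<tau>
    using lborel_integrable_real_affine[OF R, of 1 "- \<tau>"] by simp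
  have Rn: "(LINT y|lborel. norm (R (y - \<tau>))) = vline_norm (1 + \<gamma> - c0) \<rho>" for \<tau>
    using lborel_integral_real_affine[of 1 "\<lambda>y. norm (R y)" "- \<tau>"] by (simp add: vline_norm_def R_def)
  define g where "g \<tau> = fs (Complex c0 \<tau>) * Gamma (1 - Complex c0 \<tau>)" for \<tau>
  have gn: "norm (g \<tau>) \<le> Gamma (1 - c0) * norm (fs (Complex c0 \<tau>))" for \<tau>
    using mult_left_mono[OF norm_Gamma_line_le[OF c0, of \<tau>], of "norm (fs (Complex c0 \<tau>))"]
    by (simp add: g_def norm_mult mult_ac)
  have [measurable]: "g \<in> borel_measurable lborel" unfolding g_def by measurable
  define K where "K \<tau> y = g \<tau> * R (y - \<tau>)" for \<tau> y
  define B where "B \<tau> = Gamma (1 - c0) * norm (fs (Complex c0 \<tau>)) * vline_norm (1 + \<gamma> - c0) \<rho>" for \<tau>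
  have Kmeas: "case_prod K \<in> borel_measurable (lborel \<Otimes>\<^sub>M lborel)"
    unfolding K_def case_prod_unfold by measurable
  have Ksect: "integrable lborel (K \<tau>)" for \<tau>
    unfolding K_def[abs_def] by (intro integrable_mult_right Rs)
  have Kbound: "(LINT y|lborel. norm (K \<tau> y)) \<le> B \<tau>" for \<tau>
    using gn[of \<tau>] by (simp add: K_def norm_mult Rn B_def mult_right_mono vline_norm_def)
  have Bint: "integrable lborel B"
    unfolding B_def using int by (intro integrable_mult_right integrable_mult_left integrable_norm)
  note K = integrable_pair_bounded_sections[of K, OF Kmeas Ksect Kbound Bint]
  have F: "Ftrans r f (Complex \<gamma> y) = 1 / (2 * of_real pi) * (LINT \<tau>|lborel. K \<tau> y)" for y
  proof -
    have "1 + Complex \<gamma> y - Complex c0 \<tau> = Complex (1 + \<gamma> - c0) (y - \<tau>)" for \<tau>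
      by (simp add: complex_eq_iff)
    then show ?thesis
      using Ftrans_line_formula(2)[OF rep, of "Complex \<gamma> y"] by (simp add: K_def g_def R_def)
  qed
  show "vline_integrable \<gamma> (Ftrans r f)"
    unfolding vline_integrable_def F by (intro integrable_mult_right lborel_pair.integrable_snd K(1))
  have "vline_norm \<gamma> (Ftrans r f) = 1 / (2 * pi) * (LINT y|lborel. norm (LINT \<tau>|lborel. K \<tau> y))"
    by (simp add: vline_norm_def F norm_mult norm_divide)
  also have "\<dots> \<le> 1 / (2 * pi) * (LINT \<tau>|lborel. B \<tau>)"
    by (rule mult_left_mono[OF K(2)]) simp
  also have "(LINT \<tau>|lborel. B \<tau>) = Gamma (1 - c0) * vline_norm c0 fs * vline_norm (1 + \<gamma> - c0) \<rho>"
    by (simp add: B_def vline_norm_def)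
  finally show "vline_norm \<gamma> (Ftrans r f)
           \<le> Gamma (1 - c0) * vline_norm (1 + \<gamma> - c0) \<rho> * (1 / (2 * pi) * vline_norm c0 fs)"
    by (simp add: mult_ac)
qed

lemma Ftrans_linear:
  assumes f: "mellin_rep c0 f fs" and g: "mellin_rep c0 g gs" and z: "Re z = \<gamma>"
  shows "Ftrans r (\<lambda>x. \<alpha> * f x + \<beta> * g x) z = \<alpha> * Ftrans r f z + \<beta> * Ftrans r g z"
proof -
  have "Ftrans r (\<lambda>x. \<alpha> * f x + \<beta> * g x) z
      = (LBINT x:{0<..}. \<alpha> * (kminus r z x * f x) + \<beta> * (kminus r z x * g x))"
    by (simp add: Ftrans_def algebra_simps)
  also have "\<dots> = \<alpha> * Ftrans r f z + \<beta> * Ftrans r g z"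
    using Ftrans_eq_mellin(1)[OF f z] Ftrans_eq_mellin(1)[OF g z]
    by (simp add: Ftrans_def)
  finally show ?thesis .
qed

text \<open>
  Mellin inversion of \<open>L f (1/t) / r(t)\<close> at \<open>t = 1/p\<close>, multiplied by \<open>r(1/p)\<close>.
\<close>

lemma laplace_eq_Ftrans:
  assumes rep: "mellin_rep c0 f fs" and p: "p > 0"
  shows "2 * of_real pi * laplace f p
           = (LINT y|lborel. Ftrans r f (Complex \<gamma> y) * (of_real p powr Complex \<gamma> y * r (1 / p)))"
proof -
  define g where "g t = laplace f (1 / t) / r t" for t
  have M: "mellin g (Complex \<gamma> y) = Ftrans r f (Complex \<gamma> y)" for y
    unfolding g_def by (rule Ftrans_eq_mellin(2)[OF rep, symmetric]) simp
  have "g (1 / p) = 1 / (2 * of_real pi) *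
      (LINT y|lborel. mellin g (Complex \<gamma> y) * of_real (1 / p) powr (- Complex \<gamma> y))"
  proof (rule mellin_inversion)
    show "continuous_on {0<..} g"
      unfolding g_def
      by (intro continuous_intros continuous_on_compose2[OF continuous_on_laplace_mellin_rep[OF c0 rep]]
          continuous_on_subset[OF continuous_on_r]) (auto simp: r_nz)
    have "set_integrable lborel {0<..} (\<lambda>t. of_real t powr (of_real \<gamma> - 1) * g t)"
      unfolding g_def by (rule Ftrans_eq_mellin(3)[OF rep]) simp
    then show "set_integrable lborel {0<..} (\<lambda>t. of_real (t powr (\<gamma> - 1)) * g t)"
    proof (rule set_integrable_cong[THEN iffD1, rotated 3])
      show "of_real t powr (of_real \<gamma> - 1) * g t = of_real (t powr (\<gamma> - 1)) * g t" if "t \<in> {0<..}" for t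
      proof -
        have "complex_of_real \<gamma> - 1 = of_real (\<gamma> - 1)" by simp
        then show ?thesis using that by (simp only: powr_of_real greaterThan_iff less_imp_le)
      qed
    qed simp_all
    show "vline_integrable \<gamma> (mellin g)"
      using Ftrans_bounded(1)[OF rep] by (simp add: vline_integrable_def M)
  qed (use p in simp)
  moreover have "of_real (1 / p) powr (- Complex \<gamma> y) = of_real p powr Complex \<gamma> y" for y
    using p by (simp add: of_real_powr_exp ln_div del: of_real_divide)
  ultimately have "laplace f p / r (1 / p) = 1 / (2 * of_real pi) *
      (LINT y|lborel. Ftrans r f (Complex \<gamma> y) * of_real p powr Complex \<gamma> y)"
    by (simp only: g_def[of "1 / p"] M) simp
  then have "2 * of_real pi * laplace f p
      = (LINT y|lborel. Ftrans r f (Complex \<gamma> y) * of_real p powr Complex \<gamma> y) * r (1 / p)"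
    using r_nz[of "1 / p"] p by (simp add: field_simps)
  also have "\<dots> = (LINT y|lborel. Ftrans r f (Complex \<gamma> y) * (of_real p powr Complex \<gamma> y * r (1 / p)))"
    by (simp only: mult.assoc flip: integral_mult_left_zero)
  finally show ?thesis .
qed

end

section \<open>The inverse kernel and its Laplace transform\<close>

text \<open>
  Every factor \<open>b + i\<close> with \<open>i \<ge> 1\<close> is at least one. The point is a positive lower
  bound independent of \<open>k\<close>, so that dividing coefficients by these symbols preserves
  convergence.
\<close>

lemma pochhammer_ge_min:
  assumes b: "(b :: real) > 0"
  shows "pochhammer b k \<ge> min 1 b"
proof (induction k)
  case (Suc k)
  show ?case
  proof (cases k)
    case (Suc m)
    have "min 1 b * 1 \<le> pochhammer b k * (b + real k)"
      using Suc.IH b \<open>k = Suc m\<close> by (intro mult_mono) (auto intro: less_imp_le pochhammer_pos)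
    then show ?thesis by (simp add: pochhammer_Suc)
  qed simp
qed simp

text \<open>
  Factor by factor, since \<open>Re (w + i) \<le> |w + i|\<close>. This bounds \<open>1 / |\<Gamma>(k - z)|\<close> by
  \<open>1 / |\<Gamma>(-z)|\<close> times a quantity that depends on \<open>Re z\<close> only.
\<close>

lemma norm_pochhammer_ge:
  assumes w: "Re w > 0"
  shows "pochhammer (Re w) k \<le> norm (pochhammer w k)"
  unfolding pochhammer_prod prod_norm[symmetric]
proof (rule prod_mono)
  fix i
  show "0 \<le> Re w + of_nat i \<and> Re w + of_nat i \<le> norm (w + of_nat i)"
    using w abs_Re_le_cmod[of "w + of_nat i"] by auto
qed

lemma Gamma_add_nat:
  assumes w: "Re w > 0"
  shows "Gamma (of_nat k + w) = pochhammer w k * Gamma w" and "Gamma (of_nat k + w) \<noteq> 0"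
proof -
  have w': "w \<notin> \<int>\<^sub>\<le>\<^sub>0" and kw: "of_nat k + w \<notin> \<int>\<^sub>\<le>\<^sub>0"
    using w by (auto elim!: nonpos_Ints_cases simp: complex_eq_iff)
  then show "Gamma (of_nat k + w) \<noteq> 0" by (simp add: Gamma_eq_zero_iff)
  show "Gamma (of_nat k + w) = pochhammer w k * Gamma w"
    using w' by (simp add: pochhammer_Gamma Gamma_eq_zero_iff add.commute)
qed

context mellin_kernel
begin

text \<open>
  The series of \<open>khat\<close> with absolute values, after replacing \<open>1 / |\<Gamma>(k - z)|\<close> by its bound
  \<open>1 / (pochhammer (-\<gamma>) k * |\<Gamma>(-z)|)\<close> on the line \<open>Re z = \<gamma>\<close> and dropping the factor that
  depends on \<open>z\<close>.
\<close>

definition khat_majorant :: "real \<Rightarrow> real" where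
  "khat_majorant x = x powr (- \<gamma> - 1) * (\<Sum>k. norm (a k) / pochhammer (- \<gamma>) k * x ^ k)"

context
  assumes \<gamma>_neg: "\<gamma> < 0"
begin

lemma poch_pos: "pochhammer (- \<gamma>) k > 0"
  by (rule pochhammer_pos) (use \<gamma>_neg in simp)

lemma summable_khat_majorant:
  assumes "x \<ge> 0" shows "summable (\<lambda>k. norm (a k) / pochhammer (- \<gamma>) k * x ^ k)"
proof (rule summable_comparison_test'[where N = 0])
  show "summable (\<lambda>k. inverse (min 1 (- \<gamma>)) * (norm (a k) * x ^ k))"
    by (intro summable_mult summable_coeffs assms)
  fix k
  have "inverse (pochhammer (- \<gamma>) k) \<le> inverse (min 1 (- \<gamma>))"
    using pochhammer_ge_min[of "- \<gamma>" k] \<gamma>_neg by (intro le_imp_inverse_le) auto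
  from mult_right_mono[OF this, of "norm (a k) * x ^ k"]
  show "norm (norm (a k) / pochhammer (- \<gamma>) k * x ^ k) \<le> inverse (min 1 (- \<gamma>)) * (norm (a k) * x ^ k)"
    using assms poch_pos[of k] by (simp add: divide_inverse abs_mult mult_ac)
qed

lemma continuous_on_khat_majorant: "continuous_on {0<..} khat_majorant"
proof -
  have "continuous_on UNIV (\<lambda>t :: real. \<Sum>k. norm (a k) / pochhammer (- \<gamma>) k * of_real t ^ k)"
    by (rule continuous_on_entire_power_series)
       (use summable_khat_majorant poch_pos in \<open>simp add: less_imp_le\<close>)
  then have "continuous_on {0<..} (\<lambda>x. \<Sum>k. norm (a k) / pochhammer (- \<gamma>) k * x ^ k)"
    unfolding of_real_eq_id id_apply by (rule continuous_on_subset) simp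
  then show ?thesis
    unfolding khat_majorant_def by (intro continuous_intros) auto
qed

lemma norm_khat_term_le:
  assumes z: "Re z = \<gamma>" and x: "x > 0"
  shows "norm (khat_term a z x k)
           \<le> x powr (- \<gamma> - 1) * (norm (a k) / pochhammer (- \<gamma>) k * x ^ k) / norm (Gamma (- z))"
proof -
  have w: "Re (- z) > 0" using z \<gamma>_neg by simp
  have "x powr (real k - \<gamma> - 1) = x powr (- \<gamma> - 1) * x ^ k"
    using x by (simp add: algebra_simps flip: powr_realpow powr_add)
  then have "norm (khat_term a z x k) = norm (a k) * (x powr (- \<gamma> - 1) * x ^ k) / (norm (pochhammer (- z) k) * norm (Gamma (- z)))"
    using Gamma_add_nat(1)[OF w, of k] x z
    by (simp add: khat_term_def norm_divide norm_mult norm_powr_real_powr)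
  also have "\<dots> \<le> norm (a k) * (x powr (- \<gamma> - 1) * x ^ k) / (pochhammer (- \<gamma>) k * norm (Gamma (- z)))"
    using norm_pochhammer_ge[OF w, of k] poch_pos[of k] z x Gamma_add_nat(2)[OF w, of 0]
    by (intro divide_left_mono mult_right_mono mult_nonneg_nonneg mult_pos_pos) auto
  finally show ?thesis by (simp add: mult_ac)
qed

lemma summable_norm_khat_term:
  assumes z: "Re z = \<gamma>" and x: "x > 0"
  shows "summable (\<lambda>k. norm (khat_term a z x k))"
    and "norm (khat a z x) \<le> khat_majorant x / norm (Gamma (- z))"
proof -
  let ?M = "\<lambda>k. x powr (- \<gamma> - 1) * (norm (a k) / pochhammer (- \<gamma>) k * x ^ k) / norm (Gamma (- z))"
  have M: "summable ?M"
    by (intro summable_divide summable_mult summable_khat_majorant) (use x in simp)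
  show s: "summable (\<lambda>k. norm (khat_term a z x k))"
    by (rule summable_comparison_test'[OF M, of 0]) (use norm_khat_term_le[OF z x] in simp)
  have "norm (khat a z x) \<le> (\<Sum>k. norm (khat_term a z x k))"
    unfolding khat_def by (rule summable_norm[OF s])
  also have "\<dots> \<le> (\<Sum>k. ?M k)"
    by (rule suminf_le[OF norm_khat_term_le[OF z x] s M])
  also have "\<dots> = khat_majorant x / norm (Gamma (- z))"
    using suminf_divide[OF summable_mult[OF summable_khat_majorant], of x "x powr (- \<gamma> - 1)" "norm (Gamma (- z))"]
      suminf_mult[OF summable_khat_majorant, of x "x powr (- \<gamma> - 1)"] x
    unfolding khat_majorant_def by (simp del: suminf_mult)
  finally show "norm (khat a z x) \<le> khat_majorant x / norm (Gamma (- z))" .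
qed

text \<open>
  Up to the factor \<open>x powr (- z - 1)\<close>, the kernel is an everywhere convergent power series.
\<close>

lemma continuous_on_khat:
  assumes z: "Re z = \<gamma>"
  shows "continuous_on {0<..} (khat a z)"
proof -
  define b where "b k = a k / Gamma (of_nat k - z)" for k
  have w: "Re (- z) > 0" using z \<gamma>_neg by simp
  have term_eq: "khat_term a z x k = of_real x powr (- z - 1) * (b k * of_real x ^ k)" if "x > 0" for x k
  proof -
    have "of_real x powr (of_nat k - z - 1) = of_real x powr (of_nat k + (- z - 1))"
      by (simp add: algebra_simps)
    also have "\<dots> = of_real x ^ k * complex_of_real x powr (- z - 1)"
      using that by (simp only: powr_add) (simp add: powr_nat')
    finally show ?thesis by (simp add: khat_term_def b_def)
  qed
  have bn: "norm (b k) \<le> norm (a k) / pochhammer (- \<gamma>) k / norm (Gamma (- z))" for k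
    using norm_khat_term_le[OF z zero_less_one, of k] by (simp add: khat_term_def b_def)
  have sb: "summable (\<lambda>k. norm (b k) * x ^ k)" if "x \<ge> 0" for x
  proof (rule summable_comparison_test'[where N = 0])
    show "summable (\<lambda>k. norm (a k) / pochhammer (- \<gamma>) k * x ^ k / norm (Gamma (- z)))"
      by (intro summable_divide summable_khat_majorant that)
    show "norm (norm (b k) * x ^ k) \<le> norm (a k) / pochhammer (- \<gamma>) k * x ^ k / norm (Gamma (- z))" for k
      using mult_right_mono[OF bn[of k], of "x ^ k"] that by simp
  qed
  have "continuous_on UNIV (\<lambda>t. \<Sum>k. b k * of_real t ^ k)"
    by (rule continuous_on_entire_power_series[OF sb])
  then have "continuous_on {0<..} (\<lambda>x. of_real x powr (- z - 1) * (\<Sum>k. b k * of_real x ^ k))"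
    by (intro continuous_intros) (auto intro: continuous_on_subset)
  then show ?thesis
  proof (rule continuous_on_eq)
    fix x :: real assume x: "x \<in> {0<..}"
    have "summable (\<lambda>k. b k * of_real x ^ k)"
      by (rule summable_norm_cancel) (use sb[of x] x in \<open>simp add: norm_mult norm_power\<close>)
    then show "of_real x powr (- z - 1) * (\<Sum>k. b k * of_real x ^ k) = khat a z x"
      using x by (simp add: khat_def term_eq suminf_mult)
  qed
qed

lemma khat_measurable:
  "(\<lambda>(x, y). khat a (Complex \<gamma> y) x) \<in> borel_measurable (borel \<Otimes>\<^sub>M borel)"
  unfolding khat_def khat_term_def case_prod_unfold by measurable

text \<open>
  The symbol \<open>pochhammer (-\<gamma>) k\<close> in the denominator cancels against
  \<open>\<Gamma>(k - \<gamma>) = pochhammer (-\<gamma>) k * \<Gamma>(-\<gamma>)\<close>, which leaves the terms of the absolutely convergent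
  series for \<open>r(1/p)\<close>.
\<close>

lemma laplace_khat_majorant_term:
  fixes p :: real and k :: nat
  defines "g \<equiv> \<lambda>x. indicator {0<..} x *\<^sub>R
    (exp (- (p * x)) * (x powr (- \<gamma> - 1) * (norm (a k) / pochhammer (- \<gamma>) k * x ^ k)))"
  assumes p: "p > 0"
  shows "integrable lborel g"
    and "integral\<^sup>L lborel g = Gamma (- \<gamma>) * p powr \<gamma> * (norm (a k) * (1 / p) ^ k)"
proof -
  define h where "h x = indicator {0<..} x *\<^sub>R (exp (- (p * x)) * x powr ((real k - \<gamma>) - 1))" for x
  have pos: "real k - \<gamma> > 0" using \<gamma>_neg by (simp add: add_nonneg_pos)
  have h: "integrable lborel h" "integral\<^sup>L lborel h = Gamma (real k - \<gamma>) * p powr (- (real k - \<gamma>))"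
    using Gamma_integral_scaled_real[OF pos p]
    by (simp_all add: h_def[abs_def] set_integrable_def set_lebesgue_integral_def)
  have g: "g = (\<lambda>x. norm (a k) / pochhammer (- \<gamma>) k * h x)"
  proof
    fix x
    show "g x = norm (a k) / pochhammer (- \<gamma>) k * h x"
    proof (cases "x > 0")
      case True
      then have "x powr ((real k - \<gamma>) - 1) = x powr (- \<gamma> - 1) * x ^ k"
        by (simp add: algebra_simps flip: powr_realpow powr_add)
      then show ?thesis by (simp add: g_def h_def)
    qed (simp add: g_def h_def)
  qed
  show "integrable lborel g" unfolding g by (intro integrable_mult_right h)
  have "Gamma (real k - \<gamma>) = pochhammer (- \<gamma>) k * Gamma (- \<gamma>)"
  proof -
    have "- \<gamma> \<notin> \<int>\<^sub>\<le>\<^sub>0" using \<gamma>_neg by (auto elim!: nonpos_Ints_cases)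
    then show ?thesis by (simp add: pochhammer_Gamma Gamma_eq_zero_iff)
  qed
  moreover have "p powr (- (real k - \<gamma>)) = p powr \<gamma> * (1 / p) ^ k"
  proof -
    have "p powr (- (real k - \<gamma>)) = p powr \<gamma> * p powr (- real k)"
      by (simp flip: powr_add)
    then show ?thesis using p by (simp add: powr_minus powr_realpow power_one_over divide_inverse power_inverse)
  qed
  ultimately show "integral\<^sup>L lborel g = Gamma (- \<gamma>) * p powr \<gamma> * (norm (a k) * (1 / p) ^ k)"
    using poch_pos[of k] by (simp add: g h(2))
qed

lemma laplace_khat_majorant_integrable:
  assumes p: "p > 0"
  shows "set_integrable lborel {0<..} (\<lambda>x. exp (- (p * x)) * khat_majorant x)"
proof -
  define g where "g k x = indicator {0<..} x *\<^sub>R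
    (exp (- (p * x)) * (x powr (- \<gamma> - 1) * (norm (a k) / pochhammer (- \<gamma>) k * x ^ k)))" for k x
  note g = laplace_khat_majorant_term[OF p, folded g_def]
  have g0: "g k x \<ge> 0" for k x
    using poch_pos[of k] by (simp add: g_def indicator_def)
  have sums: "(\<lambda>k. g k x) sums (indicator {0<..} x *\<^sub>R (exp (- (p * x)) * khat_majorant x))" for x
  proof (cases "x > 0")
    case True
    then show ?thesis
      using sums_mult[OF sums_mult[OF summable_sums[OF summable_khat_majorant[of x]]], of "exp (- (p * x))" "x powr (- \<gamma> - 1)"]
      by (simp add: g_def khat_majorant_def)
  qed (simp add: g_def)
  have "integrable lborel (\<lambda>x. \<Sum>k. g k x)"
  proof (rule integrable_suminf[OF g(1)])
    show "AE x in lborel. summable (\<lambda>k. norm (g k x))" using sums g0 by (simp add: sums_iff)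
    show "summable (\<lambda>k. LINT x|lborel. norm (g k x))"
      using g0 p by (simp add: g(2) summable_mult summable_coeffs)
  qed
  then show ?thesis
    using sums by (simp add: sums_iff set_integrable_def)
qed

text \<open>
  Termwise, the Gamma function in the denominator cancels against the Laplace transform of
  \<open>x powr (k - z - 1)\<close>, and \<open>a k * p powr (z - k)\<close> remains. The majorant justifies the exchange of sum
  and integral.
\<close>

lemma laplace_khat:
  assumes z: "Re z = \<gamma>" and p: "p > 0"
  shows "laplace (khat a z) p = of_real p powr z * r (1 / p)"
proof -
  define g where "g k x = indicator {0<..} x *\<^sub>R (of_real (exp (- (p * x))) * khat_term a z x k)" for k x
  have pos: "Re (of_nat k - z) > 0" for k using \<gamma>_neg z by (simp add: add_nonneg_pos)
  have w: "Re (- z) > 0" using z \<gamma>_neg by simp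
  have geq: "g k x = a k / Gamma (of_nat k - z) *
      (indicator {0<..} x *\<^sub>R (of_real (exp (- (p * x))) * of_real x powr ((of_nat k - z) - 1)))" for k x
    by (simp add: g_def khat_term_def)
  have gi: "integrable lborel (g k)" for k
    unfolding geq using Gamma_integral_scaled(1)[OF pos[of k] p] by (intro integrable_mult_right) (simp add: set_integrable_def)
  have gI: "integral\<^sup>L lborel (g k) = of_real p powr z * (a k * of_real (1 / p) ^ k)" for k
  proof -
    have "integral\<^sup>L lborel (g k) = a k / Gamma (of_nat k - z) * (Gamma (of_nat k - z) * of_real p powr (- (of_nat k - z)))"
      unfolding geq integral_mult_right_zero
      using Gamma_integral_scaled(2)[OF pos[of k] p] by (simp add: set_lebesgue_integral_def)
    also have "\<dots> = a k * of_real p powr (- (of_nat k - z))"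
      using Gamma_add_nat(2)[OF w, of k] by simp
    also have "of_real p powr (- (of_nat k - z)) = of_real p powr z * of_real (1 / p) ^ k"
    proof -
      have "complex_of_real p powr (- (of_nat k - z)) = of_real p powr (z - of_nat k)" by simp
      also have "\<dots> = of_real p powr z / of_real p ^ k"
        using p by (simp add: powr_diff powr_nat')
      finally show ?thesis by (simp add: power_one_over field_simps)
    qed
    finally show ?thesis by (simp add: mult_ac)
  qed
  define m where "m k x = indicator {0<..} x *\<^sub>R
    (exp (- (p * x)) * (x powr (- \<gamma> - 1) * (norm (a k) / pochhammer (- \<gamma>) k * x ^ k)))" for k x
  note m = laplace_khat_majorant_term[OF p, folded m_def]
  have nle: "norm (g k x) \<le> inverse (norm (Gamma (- z))) * m k x" for k x
  proof (cases "x > 0")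
    case True
    then show ?thesis
      using mult_left_mono[OF norm_khat_term_le[OF z True, of k], of "exp (- (p * x))"]
      by (simp add: g_def m_def norm_mult divide_inverse mult_ac)
  qed (simp add: g_def m_def)
  have "(\<lambda>k. integral\<^sup>L lborel (g k)) sums (LINT x|lborel. (\<Sum>k. g k x))"
  proof (rule sums_integral[OF gi])
    show "AE x in lborel. summable (\<lambda>k. norm (g k x))"
    proof (rule AE_I2)
      fix x
      show "summable (\<lambda>k. norm (g k x))"
      proof (cases "x > 0")
        case True
        then show ?thesis
          using summable_mult[OF summable_norm_khat_term(1)[OF z True], of "exp (- (p * x))"] by (simp add: g_def norm_mult)
      qed (simp add: g_def)
    qed
    show "summable (\<lambda>k. LINT x|lborel. norm (g k x))"
    proof (rule summable_comparison_test'[where N = 0])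
      show "summable (\<lambda>k. inverse (norm (Gamma (- z))) * (Gamma (- \<gamma>) * p powr \<gamma> * (norm (a k) * (1 / p) ^ k)))"
        using p by (intro summable_mult summable_coeffs) simp
      show "norm (LINT x|lborel. norm (g k x)) \<le> inverse (norm (Gamma (- z))) * (Gamma (- \<gamma>) * p powr \<gamma> * (norm (a k) * (1 / p) ^ k))" for k
      proof -
        have "(LINT x|lborel. norm (g k x)) \<le> (LINT x|lborel. inverse (norm (Gamma (- z))) * m k x)"
          by (intro integral_mono integrable_norm gi integrable_mult_right m nle)
        then show ?thesis by (simp add: m)
      qed
    qed
  qed
  moreover have "(\<Sum>k. g k x) = indicator {0<..} x *\<^sub>R (of_real (exp (- (p * x))) * khat a z x)" for x
  proof (cases "x > 0")
    case True
    then show ?thesis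
      using suminf_mult[OF summable_norm_cancel[OF summable_norm_khat_term(1)[OF z True]], of "of_real (exp (- (p * x)))"]
      by (simp add: g_def khat_def)
  qed (simp add: g_def)
  ultimately have "(\<lambda>k. of_real p powr z * (a k * of_real (1 / p) ^ k)) sums laplace (khat a z) p"
    by (simp only: gI laplace_def set_lebesgue_integral_def)
  moreover have "(\<lambda>k. of_real p powr z * (a k * of_real (1 / p) ^ k)) sums (of_real p powr z * r (1 / p))"
    by (intro sums_mult r_sums)
  ultimately show ?thesis by (rule sums_unique2)
qed

end

end

section \<open>Inversion and the operator norm\<close>

context mellin_kernel
begin

text \<open>
  The right-hand side \<open>h\<close> is continuous in \<open>x\<close> and its Laplace transform can be computed under the
  integral over \<open>y\<close>, because \<open>khat_majorant x * |F f (z) / \<Gamma>(-z)|\<close> dominates the integrand. By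
  \<open>laplace_khat\<close> and \<open>laplace_eq_Ftrans\<close> that transform is \<open>2 \<pi> L f\<close>.
\<close>

lemma Ftrans_inversion:
  assumes \<gamma>_neg: "\<gamma> < 0" and rep: "mellin_rep c0 f fs"
    and FG: "vline_integrable \<gamma> (\<lambda>z. Ftrans r f z / Gamma (- z))" and x: "x > 0"
  shows "vline_integrable \<gamma> (\<lambda>z. khat a z x * Ftrans r f z)"
    and "f x = 1 / (2 * of_real pi) * (LINT y|lborel. khat a (Complex \<gamma> y) x * Ftrans r f (Complex \<gamma> y))"
proof -
  note khat_measurable[OF \<gamma>_neg, measurable]
  define F where "F y = Ftrans r f (Complex \<gamma> y)" for y
  define w where "w y = norm (F y / Gamma (- Complex \<gamma> y))" for y
  have w: "integrable lborel w"
    using FG unfolding vline_integrable_def w_def[abs_def] F_def[abs_def] by (rule integrable_norm)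
  have [measurable]: "F \<in> borel_measurable borel"
    using Ftrans_bounded(1)[OF rep] unfolding vline_integrable_def F_def[abs_def]
    by (simp add: borel_measurable_integrable)
  define K where "K x y = khat a (Complex \<gamma> y) x * F y" for x y
  have Km: "(\<lambda>(x, y). K x y) \<in> borel_measurable (borel \<Otimes>\<^sub>M borel)"
    unfolding K_def case_prod_unfold by measurable
  then have Kx [measurable]: "K x \<in> borel_measurable lborel" for x
    using measurable_Pair2[OF Km, of x] by simp
  have Kn: "norm (K x y) \<le> khat_majorant x * w y" if "x > 0" for x y
    using mult_right_mono[OF summable_norm_khat_term(2)[OF \<gamma>_neg _ that, of "Complex \<gamma> y"], of "norm (F y)"]
    by (simp add: K_def w_def norm_mult norm_divide)
  have "integrable lborel (K x)"
    by (rule Bochner_Integration.integrable_bound[where f = "\<lambda>y. khat_majorant x * w y"])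
       (use w Kn[OF x] in \<open>auto intro!: AE_I2 intro: order_trans[OF _ abs_ge_self]\<close>)
  then show "vline_integrable \<gamma> (\<lambda>z. khat a z x * Ftrans r f z)"
    by (simp add: vline_integrable_def K_def[abs_def] F_def)

  define h where "h x = (LINT y|lborel. K x y)" for x
  have h_cont: "continuous_on {0<..} h"
    unfolding h_def
  proof (rule continuous_on_integral_dominated[OF Kx _ w continuous_on_khat_majorant[OF \<gamma>_neg]])
    show "continuous_on {0<..} (\<lambda>x. K x y)" for y
      unfolding K_def by (intro continuous_intros continuous_on_khat[OF \<gamma>_neg]) simp
  qed (use Kn in \<open>auto simp: w_def\<close>)

  have h_laplace: "set_integrable lborel {0<..} (\<lambda>x. of_real (exp (- (p * x))) * h x)"
      "laplace h p = 2 * of_real pi * laplace f p" if p: "p > 0" for p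
  proof -
    define J where "J x y = (indicator {0<..} x *\<^sub>R of_real (exp (- (p * x)))) * K x y" for x y
    have J0: "J x = (\<lambda>y. 0)" if "\<not> x > 0" for x using that by (simp add: J_def fun_eq_iff)
    have Jn: "norm (J x y) \<le> (indicator {0<..} x *\<^sub>R (exp (- (p * x)) * khat_majorant x)) * w y" for x y
    proof (cases "x > 0")
      case True
      then show ?thesis
        using mult_left_mono[OF Kn[OF True, of y], of "exp (- (p * x))"] by (simp add: J_def norm_mult mult.assoc)
    qed (simp add: J0)
    have Jm [measurable]: "J x \<in> borel_measurable lborel" for x unfolding J_def[abs_def] by measurable
    have Ji: "integrable lborel (J x)" for x
      by (rule Bochner_Integration.integrable_bound[where f = "\<lambda>y. (indicator {0<..} x *\<^sub>R (exp (- (p * x)) * khat_majorant x)) * w y"])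
         (use w order_trans[OF Jn abs_ge_self] in \<open>auto intro!: AE_I2\<close>)
    have Jint: "integrable (lborel \<Otimes>\<^sub>M lborel) (case_prod J)"
    proof (rule integrable_pair_bounded_sections(1)[OF _ Ji])
      show "case_prod J \<in> borel_measurable (lborel \<Otimes>\<^sub>M lborel)"
        using Km unfolding J_def case_prod_unfold by measurable
      show "(LINT y|lborel. norm (J x y)) \<le> (indicator {0<..} x *\<^sub>R (exp (- (p * x)) * khat_majorant x)) * integral\<^sup>L lborel w" for x
      proof -
        have "(LINT y|lborel. norm (J x y)) \<le> (LINT y|lborel. (indicator {0<..} x *\<^sub>R (exp (- (p * x)) * khat_majorant x)) * w y)"
          by (intro integral_mono integrable_norm Ji Jn integrable_mult_right w)
        then show ?thesis by simp
      qed
      show "integrable lborel (\<lambda>x. (indicator {0<..} x *\<^sub>R (exp (- (p * x)) * khat_majorant x)) * integral\<^sup>L lborel w)"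
        using laplace_khat_majorant_integrable[OF \<gamma>_neg p] unfolding set_integrable_def
        by (rule integrable_mult_left)
    qed
    have fst: "(LINT y|lborel. J x y) = indicator {0<..} x *\<^sub>R (of_real (exp (- (p * x))) * h x)" for x
      by (simp add: J_def h_def)
    have snd: "(LINT x|lborel. J x y) = F y * (of_real p powr Complex \<gamma> y * r (1 / p))" for y
    proof -
      have "J x y = F y * (indicator {0<..} x *\<^sub>R (of_real (exp (- (p * x))) * khat a (Complex \<gamma> y) x))" for x
        by (simp add: J_def K_def mult_ac)
      then have "(LINT x|lborel. J x y) = F y * laplace (khat a (Complex \<gamma> y)) p"
        by (simp only: integral_mult_right_zero laplace_def set_lebesgue_integral_def)
      then show ?thesis using laplace_khat[OF \<gamma>_neg _ p, of "Complex \<gamma> y"] by simp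
    qed
    show "set_integrable lborel {0<..} (\<lambda>x. of_real (exp (- (p * x))) * h x)"
      using lborel_pair.integrable_fst[OF Jint] by (simp only: fst set_integrable_def)
    have "laplace h p = (LINT x|lborel. LINT y|lborel. J x y)"
      by (simp only: fst laplace_def set_lebesgue_integral_def)
    also have "\<dots> = (LINT y|lborel. LINT x|lborel. J x y)"
      by (rule lborel_pair.Fubini_integral[OF Jint, symmetric])
    also have "\<dots> = 2 * of_real pi * laplace f p"
      using laplace_eq_Ftrans[OF rep p] by (simp only: snd F_def)
    finally show "laplace h p = 2 * of_real pi * laplace f p" .
  qed

  have "2 * of_real pi * f x - h x = 0"
  proof (rule laplace_transform_injective[OF _ _ _ x])
    show "continuous_on {0<..} (\<lambda>x. 2 * of_real pi * f x - h x)"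
      by (intro continuous_intros continuous_on_mellin_rep[OF rep] h_cont)
    fix p :: real assume p: "p > 0"
    have eq: "of_real (exp (- (p * x))) * (2 * of_real pi * f x - h x)
        = 2 * of_real pi * (of_real (exp (- (p * x))) * f x) - of_real (exp (- (p * x))) * h x" for x
      by (simp add: algebra_simps)
    note int = set_integrable_mult_right[OF laplace_integrable(1)[OF c0 rep p], of "2 * of_real pi"] h_laplace(1)[OF p]
    show "set_integrable lborel {0<..} (\<lambda>x. of_real (exp (- (p * x))) * (2 * of_real pi * f x - h x))"
      unfolding eq by (rule set_integral_diff(1)[OF int])
    show "(LBINT x:{0<..}. of_real (exp (- (p * x))) * (2 * of_real pi * f x - h x)) = 0"
      unfolding eq set_integral_diff(2)[OF int] set_integral_mult_right
      using h_laplace(2)[OF p] by (simp add: laplace_def)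
  qed
  then show "f x = 1 / (2 * of_real pi) * (LINT y|lborel. khat a (Complex \<gamma> y) x * Ftrans r f (Complex \<gamma> y))"
    by (simp add: h_def K_def F_def field_simps)
qed

text \<open>
  The norm of \<open>f\<close> is computed from the representing function that \<open>mellin_star\<close> selects, and
  \<open>Ftrans_bounded\<close> holds for every representing function, in particular for this one.
\<close>

lemma Ftrans_norm_le:
  assumes "f \<in> mellin_inv_space c0"
  shows "vline_norm \<gamma> (Ftrans r f) \<le> Gamma (1 - c0) * vline_norm (1 + \<gamma> - c0) \<rho> * mellin_inv_norm c0 f"
proof -
  have "mellin_rep c0 f (mellin_star c0 f)"
    using assms unfolding mellin_inv_space_def mellin_star_def by (simp add: someI_ex)
  from Ftrans_bounded(2)[OF this] show ?thesis by (simp add: mellin_inv_norm_def)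
qed

lemma bounded_op_Ftrans: "bounded_op c0 \<gamma> (Ftrans r)"
  unfolding bounded_op_def
proof (intro conjI ballI allI impI exI)
  fix f g \<alpha> \<beta> z
  assume "f \<in> mellin_inv_space c0" "g \<in> mellin_inv_space c0" "Re z = \<gamma>"
  then show "Ftrans r (\<lambda>x. \<alpha> * f x + \<beta> * g x) z = \<alpha> * Ftrans r f z + \<beta> * Ftrans r g z"
    using Ftrans_linear by (auto simp: mellin_inv_space_def)
qed (use Ftrans_bounded(1) Ftrans_norm_le in \<open>auto simp: mellin_inv_space_def\<close>)

lemma op_norm_Ftrans_le:
  "op_norm c0 \<gamma> (Ftrans r) \<le> Gamma (1 - c0) * (LINT \<tau>|lborel. cmod (\<rho> (Complex (1 - c0 + \<gamma>) (- \<tau>))))"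
proof -
  have "(LINT \<tau>|lborel. cmod (\<rho> (Complex (1 - c0 + \<gamma>) (- \<tau>)))) = vline_norm (1 + \<gamma> - c0) \<rho>"
    using lborel_integral_real_affine[of "-1" "\<lambda>y. cmod (\<rho> (Complex (1 + \<gamma> - c0) y))" 0]
    by (simp add: vline_norm_def algebra_simps)
  moreover have "op_norm c0 \<gamma> (Ftrans r) \<le> Gamma (1 - c0) * vline_norm (1 + \<gamma> - c0) \<rho>"
    unfolding op_norm_def
  proof (rule cInf_lower)
    have "Gamma (1 - c0) > 0" using c0 by (simp add: Gamma_real_pos)
    then show "Gamma (1 - c0) * vline_norm (1 + \<gamma> - c0) \<rho> \<in>
        {K. 0 \<le> K \<and> (\<forall>f\<in>mellin_inv_space c0. vline_norm \<gamma> (Ftrans r f) \<le> K * mellin_inv_norm c0 f)}"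
      using Ftrans_norm_le by (auto simp: vline_norm_def)
  qed (auto intro: bdd_belowI[where m = 0])
  ultimately show ?thesis by simp
qed

end

theorem theorem2:
  fixes c0 \<gamma> :: real and a :: "nat \<Rightarrow> complex" and r :: "real \<Rightarrow> complex"
    and \<rho> :: "complex \<Rightarrow> complex"
  assumes "c0 < 1"
    and "conv_radius a = \<infinity>"
    and "\<And>t. r t = (\<Sum>k. a k * of_real t ^ k)"
    and "\<And>t. t > 0 \<Longrightarrow> r t \<noteq> 0"
    and "set_integrable lborel {0<..} (\<lambda>t. of_real (t powr (\<gamma> - c0)) * (1 / r t))"
    and "\<And>s. \<rho> s = mellin (\<lambda>t. 1 / r t) s"
    and "vline_integrable (1 + \<gamma> - c0) \<rho>"
  shows "(\<forall>f fs. mellin_rep c0 f fs \<longrightarrow>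
            (\<forall>z. Re z = \<gamma> \<longrightarrow>
               (\<forall>x>0. set_integrable lborel {0<..} (kminus_integrand r z x)) \<and>
               set_integrable lborel {0<..} (\<lambda>x. kminus r z x * f x) \<and>
               vline_integrable c0 (\<lambda>s. Gamma (1 - s) * \<rho> (1 + z - s) * fs s) \<and>
               Ftrans r f z = 1 / (2 * of_real pi * \<i>) *
                 vline_integral c0 (\<lambda>s. Gamma (1 - s) * \<rho> (1 + z - s) * fs s))) \<and>
         bounded_op c0 \<gamma> (Ftrans r) \<and>
         op_norm c0 \<gamma> (Ftrans r)
           \<le> Gamma (1 - c0) * (LINT \<tau>|lborel. cmod (\<rho> (Complex (1 - c0 + \<gamma>) (- \<tau>)))) \<and>
         (\<gamma> < 0 \<longrightarrow>
            (\<forall>f\<in>mellin_inv_space c0.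
               vline_integrable \<gamma> (\<lambda>z. Ftrans r f z / Gamma (- z)) \<longrightarrow>
               (\<forall>x>0.
                  (\<forall>z. Re z = \<gamma> \<longrightarrow> summable (khat_term a z x)) \<and>
                  vline_integrable \<gamma> (\<lambda>z. khat a z x * Ftrans r f z) \<and>
                  f x = 1 / (2 * of_real pi * \<i>) *
                    vline_integral \<gamma> (\<lambda>z. khat a z x * Ftrans r f z))))"
proof -
  interpret mellin_kernel c0 \<gamma> a r \<rho>
    by unfold_locales (fact assms)+
  show ?thesis
  proof (intro conjI allI impI ballI)
    fix f fs z assume rep: "mellin_rep c0 f fs" and z: "Re z = \<gamma>"
    show "set_integrable lborel {0<..} (kminus_integrand r z x)" if "x > 0" for x
      by (rule kminus_integrable[OF z that])
    show "set_integrable lborel {0<..} (\<lambda>x. kminus r z x * f x)"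
      by (rule Ftrans_eq_mellin(1)[OF rep z])
    show "vline_integrable c0 (\<lambda>s. Gamma (1 - s) * \<rho> (1 + z - s) * fs s)"
      using Ftrans_line_formula(1)[OF rep z] by (simp add: vline_integrable_def mult_ac)
    show "Ftrans r f z = 1 / (2 * of_real pi * \<i>) *
        vline_integral c0 (\<lambda>s. Gamma (1 - s) * \<rho> (1 + z - s) * fs s)"
      using Ftrans_line_formula(2)[OF rep z] by (simp add: vline_integral_def mult_ac)
  next
    show "bounded_op c0 \<gamma> (Ftrans r)" by (rule bounded_op_Ftrans)
    show "op_norm c0 \<gamma> (Ftrans r)
        \<le> Gamma (1 - c0) * (LINT \<tau>|lborel. cmod (\<rho> (Complex (1 - c0 + \<gamma>) (- \<tau>))))"
      by (rule op_norm_Ftrans_le)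
  next
    fix f and x :: real
    assume \<gamma>: "\<gamma> < 0" and "f \<in> mellin_inv_space c0"
      and FG: "vline_integrable \<gamma> (\<lambda>z. Ftrans r f z / Gamma (- z))" and x: "x > 0"
    then obtain fs where rep: "mellin_rep c0 f fs" by (auto simp: mellin_inv_space_def)
    show "summable (khat_term a z x)" if "Re z = \<gamma>" for z
      by (rule summable_norm_cancel[OF summable_norm_khat_term(1)[OF \<gamma> that x]])
    show "vline_integrable \<gamma> (\<lambda>z. khat a z x * Ftrans r f z)"
      by (rule Ftrans_inversion(1)[OF \<gamma> rep FG x])
    show "f x = 1 / (2 * of_real pi * \<i>) * vline_integral \<gamma> (\<lambda>z. khat a z x * Ftrans r f z)"
      using Ftrans_inversion(2)[OF \<gamma> rep FG x] by (simp add: vline_integral_def)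
  qed
qed

end
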